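(* For arbitrary $\mathbb J$ and $X$, each of the classes $\mathcal E_0(\mathbb J,X)$, $\mathcal E_n(\mathbb J,X)$, $Av_0(\mathbb J,X)$, $Av_n(\mathbb J,X)$ satisfies $(\Delta)$.
   Context: $X$ is a Banach space; $\mathbb J$ is an interval of the form $\mathbb R$, $(\alpha,\infty)$ or $[\alpha,\infty)$, $\alpha\in\mathbb R$; $\alpha_0=0$ if $\mathbb J=\mathbb R$ and $\alpha_0=\alpha+1$ otherwise. Integrals are Bochner integrals; $|f|(t)=\|f(t)\|$. $\mathcal E(\mathbb J,X)$: all $\phi\in L^1_{loc}(\mathbb J,X)$ for which there is $m(\phi)\in X$ with $\sup_{x\in\mathbb J}\left\|\frac1T\int_0^T\phi(x+s)\,ds-m(\phi)\right\|\to0$ as $T\to\infty$. $\mathcal E_0(\mathbb J,X)=\{\phi\in\mathcal E(\mathbb J,X):m(\phi)=0\}$. $\mathcal E_n(\mathbb J,X)=\{f\in\mathcal E(\mathbb J,X):|f|\in\mathcal E_0(\mathbb J,\mathbb R)\}$ (here $n$ is just a label, for "null"). $Av_0(\mathbb J,X)=\{f\in L^1_{loc}(\mathbb J,X):\lim_{T\to\infty}\frac1T\int_{\alpha_0}^{\alpha_0+T}f(t)\,dt=0\}$. $Av_n(\mathbb J,X)=\{f\in L^1_{loc}(\mathbb J,X):\lim_{T\to\infty}\frac1T\int_{\alpha_0}^{\alpha_0+T}\|f(t)\|\,dt=0\}$. For $h>0$: $\Delta_h\phi(t)=\phi(t+h)-\phi(t)$ and $M_h\phi(t)=\frac1h\int_0^h\phi(t+s)\,ds$.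 A class $\mathcal A\subset L^1_{loc}(\mathbb J,X)$ satisfies $(\Delta)$ if: whenever $\phi\in L^1_{loc}(\mathbb J,X)$ and $\Delta_s\phi\in\mathcal A$ for all $s>0$, then $\phi-M_h\phi\in\mathcal A$ for all $h>0$. *)

theory Defs
  imports "HOL-Analysis.Analysis"
begin

(* The Bochner integral of the distribution lives in second countable spaces only.  It is
   defined here for arbitrary (also non-separable) normed spaces.  It is meant for complete
   measures: there the value is unique and, for second countable spaces, the definition agrees
   with has_bochner_integral (see the lemmas).  It is only used for lebesgue_on S, S measurable. *)

definition strongly_measurable :: "'a measure \<Rightarrow> ('a \<Rightarrow> 'b::real_normed_vector) \<Rightarrow> bool" where
  "strongly_measurable M f \<longleftrightarrow>
     (\<exists>s. (\<forall>i. simple_function M (s i)) \<and> (AE x in M. (\<lambda>i::nat. s i x) \<longlonglongrightarrow> f x))"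

definition has_Bochner :: "'a measure \<Rightarrow> ('a \<Rightarrow> 'b::real_normed_vector) \<Rightarrow> 'b \<Rightarrow> bool" where
  "has_Bochner M f y \<longleftrightarrow>
     strongly_measurable M f \<and>
     (\<exists>s. (\<forall>i. Bochner_Integration.simple_bochner_integrable M (s i)) \<and>
          (\<lambda>i::nat. \<integral>\<^sup>+x. norm (f x - s i x) \<partial>M) \<longlonglongrightarrow> 0 \<and>
          (\<lambda>i. Bochner_Integration.simple_bochner_integral M (s i)) \<longlonglongrightarrow> y)"

definition Bochner_integrable :: "'a measure \<Rightarrow> ('a \<Rightarrow> 'b::real_normed_vector) \<Rightarrow> bool" where
  "Bochner_integrable M f \<longleftrightarrow> (\<exists>y. has_Bochner M f y)"

definition Bochner_integral :: "'a measure \<Rightarrow> ('a \<Rightarrow> 'b::real_normed_vector) \<Rightarrow> 'b" where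
  "Bochner_integral M f = (THE y. has_Bochner M f y)"

lemma borel_measurable_AE_limit:
  fixes s :: "nat \<Rightarrow> 'a \<Rightarrow> 'b::{real_normed_vector, second_countable_topology}"
  assumes "complete_measure M" and s: "\<And>i. s i \<in> borel_measurable M"
    and lim: "AE x in M. (\<lambda>i. s i x) \<longlonglongrightarrow> f x"
  shows "f \<in> borel_measurable M"
proof -
  interpret complete_measure M by fact
  obtain N where N: "N \<in> null_sets M" "\<And>x. x \<in> space M - N \<Longrightarrow> (\<lambda>i. s i x) \<longlonglongrightarrow> f x"
    using lim by (elim AE_E3) auto
  have Nm: "N \<in> sets M" using N by auto
  define g where "g = (\<lambda>x. indicator (space M - N) x *\<^sub>R f x)"
  have g: "g \<in> borel_measurable M"
  proof (rule borel_measurable_LIMSEQ_metric)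
    show "(\<lambda>x. indicator (space M - N) x *\<^sub>R s i x) \<in> borel_measurable M" for i
      using s Nm by measurable
    show "(\<lambda>i. indicator (space M - N) x *\<^sub>R s i x) \<longlonglongrightarrow> g x" if "x \<in> space M" for x
      using that N(2)[of x] by (auto simp: g_def indicator_def)
  qed
  show ?thesis
  proof (rule measurableI)
    fix A :: "'b set" assume A: "A \<in> sets borel"
    have "f -` A \<inter> space M = ((g -` A \<inter> space M) - N) \<union> (f -` A \<inter> space M \<inter> N)"
      by (auto simp: g_def indicator_def)
    moreover have "f -` A \<inter> space M \<inter> N \<in> sets M"
      by (rule complete[of _ N]) (use N in auto)
    moreover have "g -` A \<inter> space M \<in> sets M"
      using g A by (rule measurable_sets)
    ultimately show "f -` A \<inter> space M \<in> sets M"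
      using Nm by (metis sets.Un sets.Diff)
  qed auto
qed

lemma strongly_measurable_norm_diff:
  assumes "complete_measure M" "strongly_measurable M f" "simple_function M t"
  shows "(\<lambda>x. norm (f x - t x)) \<in> borel_measurable M"
proof -
  obtain s where s: "\<And>i. simple_function M (s i)" "AE x in M. (\<lambda>i::nat. s i x) \<longlonglongrightarrow> f x"
    using assms(2) by (auto simp: strongly_measurable_def)
  show ?thesis
  proof (rule borel_measurable_AE_limit[OF assms(1)])
    show "(\<lambda>x. norm (s i x - t x)) \<in> borel_measurable M" for i
      by (intro borel_measurable_simple_function simple_function_compose2[OF s(1) assms(3)])
    show "AE x in M. (\<lambda>i. norm (s i x - t x)) \<longlonglongrightarrow> norm (f x - t x)"
      using s(2) by eventually_elim (intro tendsto_intros)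
  qed
qed

lemma has_Bochner_unique:
  assumes M: "complete_measure M" and f: "has_Bochner M f y" "has_Bochner M f z"
  shows "y = z"
proof -
  let ?I = "Bochner_Integration.simple_bochner_integral M"
  have sm: "strongly_measurable M f" using f by (auto simp: has_Bochner_def)
  obtain s where s: "\<And>i. Bochner_Integration.simple_bochner_integrable M (s i)"
      "(\<lambda>i::nat. \<integral>\<^sup>+x. norm (f x - s i x) \<partial>M) \<longlonglongrightarrow> 0"
      "(\<lambda>i. ?I (s i)) \<longlonglongrightarrow> y"
    using f(1) by (auto simp: has_Bochner_def)
  obtain t where t: "\<And>i. Bochner_Integration.simple_bochner_integrable M (t i)"
      "(\<lambda>i::nat. \<integral>\<^sup>+x. norm (f x - t i x) \<partial>M) \<longlonglongrightarrow> 0"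
      "(\<lambda>i. ?I (t i)) \<longlonglongrightarrow> z"
    using f(2) by (auto simp: has_Bochner_def)
  have sf: "simple_function M (s i)" "simple_function M (t i)" for i
    using s(1)[of i] t(1)[of i] by (simp_all add: simple_bochner_integrable.simps)
  have bnd: "ennreal (norm (?I (s i) - ?I (t i)))
      \<le> (\<integral>\<^sup>+x. norm (f x - s i x) \<partial>M) + (\<integral>\<^sup>+x. norm (f x - t i x) \<partial>M)" for i
  proof -
    have d: "Bochner_Integration.simple_bochner_integrable M (\<lambda>x. s i x - t i x)"
      using simple_bochner_integrable_compose2[where p="(-)", OF _ s(1) t(1)] by simp
    have "ennreal (norm (?I (s i) - ?I (t i)))
        = ennreal (norm (?I (\<lambda>x. s i x - t i x)))"
      by (simp add: simple_bochner_integral_diff s t)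
    also have "\<dots> \<le> ennreal (?I (\<lambda>x. norm (s i x - t i x)))"
      by (intro ennreal_leI simple_bochner_integral_norm_bound d)
    also have "\<dots> = (\<integral>\<^sup>+x. norm (s i x - t i x) \<partial>M)"
      using simple_bochner_integrable_compose2[where p="\<lambda>x y. norm (x - y)", OF _ s(1) t(1)]
      by (intro simple_bochner_integral_eq_nn_integral) auto
    also have "\<dots> \<le> (\<integral>\<^sup>+x. ennreal (norm (f x - s i x)) + ennreal (norm (f x - t i x)) \<partial>M)"
    proof (rule nn_integral_mono)
      fix x
      have "norm (s i x - t i x) \<le> norm (f x - s i x) + norm (f x - t i x)"
        using norm_triangle_ineq4[of "f x - t i x" "f x - s i x"] by simp
      then show "ennreal (norm (s i x - t i x))
          \<le> ennreal (norm (f x - s i x)) + ennreal (norm (f x - t i x))"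
        by (simp flip: ennreal_plus)
    qed
    also have "\<dots> = (\<integral>\<^sup>+x. norm (f x - s i x) \<partial>M) + (\<integral>\<^sup>+x. norm (f x - t i x) \<partial>M)"
      using strongly_measurable_norm_diff[OF M sm sf(1)]
        strongly_measurable_norm_diff[OF M sm sf(2)]
      by (intro nn_integral_add measurable_compose[OF _ measurable_ennreal]) assumption+
    finally show ?thesis .
  qed
  have "(\<lambda>i. ennreal (norm (?I (s i) - ?I (t i))))
      \<longlonglongrightarrow> 0"
    by (rule tendsto_sandwich[OF _ _ tendsto_const tendsto_add[OF s(2) t(2), simplified]])
       (simp_all add: bnd always_eventually)
  then have "(\<lambda>i. norm (?I (s i) - ?I (t i)))
      \<longlonglongrightarrow> 0"
    by (simp flip: ennreal_0)
  moreover have "(\<lambda>i. norm (?I (s i) - ?I (t i)))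
      \<longlonglongrightarrow> norm (y - z)"
    by (intro tendsto_intros s t)
  ultimately have "norm (y - z) = 0" using LIMSEQ_unique by blast
  then show ?thesis by simp
qed

lemma has_Bochner_iff_has_bochner_integral:
  fixes f :: "'a \<Rightarrow> 'b::{real_normed_vector, second_countable_topology}"
  assumes "complete_measure M"
  shows "has_Bochner M f y \<longleftrightarrow> has_bochner_integral M f y"
proof -
  have "strongly_measurable M f \<longleftrightarrow> f \<in> borel_measurable M"
  proof
    assume "strongly_measurable M f"
    then show "f \<in> borel_measurable M"
      unfolding strongly_measurable_def
      using borel_measurable_AE_limit[OF assms] borel_measurable_simple_function by blast
  next
    assume "f \<in> borel_measurable M"
    from borel_measurable_implies_sequence_metric[OF this, of 0]
    show "strongly_measurable M f"
      unfolding strongly_measurable_def by auto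
  qed
  then show ?thesis
    by (auto simp: has_Bochner_def has_bochner_integral.simps)
qed

lemma complete_measure_lebesgue_on:
  assumes "S \<in> sets lebesgue"
  shows "complete_measure (lebesgue_on S)"
proof
  fix A B assume AB: "B \<subseteq> A" "A \<in> null_sets (lebesgue_on S)"
  then have "A \<in> null_sets lebesgue" "A \<subseteq> S"
    using assms by (auto simp: null_sets_restrict_space)
  then have "B \<in> sets lebesgue" "B \<subseteq> S"
    using AB(1) by (auto intro: completion.complete)
  then show "B \<in> sets (lebesgue_on S)"
    using assms by (simp add: sets_restrict_space_iff)
qed

definition admissible_interval :: "real set \<Rightarrow> bool" where
  "admissible_interval J \<longleftrightarrow> J = UNIV \<or> (\<exists>\<alpha>. J = {\<alpha><..}) \<or> (\<exists>\<alpha>. J = {\<alpha>..})"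

(* Inf J is the left end point of J *)
definition alpha0 :: "real set \<Rightarrow> real" where
  "alpha0 J = (if J = UNIV then 0 else Inf J + 1)"

(* Functions on J are represented by total functions on the real line whose values outside J
   are irrelevant, and elements of L1_loc by functions rather than by classes modulo null sets. *)
definition L1_loc :: "real set \<Rightarrow> (real \<Rightarrow> 'a::banach) set" where
  "L1_loc J = {f. \<forall>K. compact K \<and> K \<subseteq> J \<longrightarrow> Bochner_integrable (lebesgue_on K) f}"

definition has_ergodic_mean :: "real set \<Rightarrow> (real \<Rightarrow> 'a::banach) \<Rightarrow> 'a \<Rightarrow> bool" where
  "has_ergodic_mean J \<phi> m \<longleftrightarrow>
     ((\<lambda>T. SUP x\<in>J. ennreal (norm
         ((1 / T) *\<^sub>R Bochner_integral (lebesgue_on {0..T}) (\<lambda>s. \<phi> (x + s)) - m))) \<longlongrightarrow> 0) at_top"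

definition ergodic_mean :: "real set \<Rightarrow> (real \<Rightarrow> 'a::banach) \<Rightarrow> 'a" where
  "ergodic_mean J \<phi> = (THE m. has_ergodic_mean J \<phi> m)"

lemma has_ergodic_mean_unique:
  assumes "J \<noteq> {}" "has_ergodic_mean J \<phi> m" "has_ergodic_mean J \<phi> m'"
  shows "m = m'"
proof -
  obtain x where x: "x \<in> J" using assms(1) by auto
  let ?A = "\<lambda>T. (1 / T) *\<^sub>R Bochner_integral (lebesgue_on {0..T}) (\<lambda>s. \<phi> (x + s))"
  have "(?A \<longlongrightarrow> k) at_top" if "has_ergodic_mean J \<phi> k" for k
  proof -
    have "((\<lambda>T. ennreal (norm (?A T - k))) \<longlongrightarrow> 0) at_top"
      by (rule tendsto_sandwich[OF _ _ tendsto_const that[unfolded has_ergodic_mean_def]])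
         (auto intro!: always_eventually SUP_upper2[OF x])
    then have "((\<lambda>T. norm (?A T - k)) \<longlongrightarrow> 0) at_top"
      by (simp flip: ennreal_0)
    then have "((\<lambda>T. ?A T - k) \<longlongrightarrow> 0) at_top"
      by (rule tendsto_norm_zero_cancel)
    then show ?thesis
      by (rule LIM_zero_cancel)
  qed
  from this[OF assms(2)] this[OF assms(3)] show ?thesis
    by (rule tendsto_unique[OF trivial_limit_at_top_linorder])
qed

definition ergodic :: "real set \<Rightarrow> (real \<Rightarrow> 'a::banach) set" where
  "ergodic J = {\<phi> \<in> L1_loc J. \<exists>m. has_ergodic_mean J \<phi> m}"

definition ergodic_0 :: "real set \<Rightarrow> (real \<Rightarrow> 'a::banach) set" where
  "ergodic_0 J = {\<phi> \<in> ergodic J. ergodic_mean J \<phi> = 0}"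

definition ergodic_null :: "real set \<Rightarrow> (real \<Rightarrow> 'a::banach) set" where
  "ergodic_null J = {f \<in> ergodic J. (\<lambda>t. norm (f t)) \<in> ergodic_0 J}"

definition Av_0 :: "real set \<Rightarrow> (real \<Rightarrow> 'a::banach) set" where
  "Av_0 J = {f \<in> L1_loc J.
     ((\<lambda>T. (1 / T) *\<^sub>R Bochner_integral (lebesgue_on {alpha0 J..alpha0 J + T}) f) \<longlongrightarrow> 0) at_top}"

definition Av_null :: "real set \<Rightarrow> (real \<Rightarrow> 'a::banach) set" where
  "Av_null J = {f \<in> L1_loc J.
     ((\<lambda>T. (1 / T) * Bochner_integral (lebesgue_on {alpha0 J..alpha0 J + T}) (\<lambda>t. norm (f t)))
        \<longlongrightarrow> 0) at_top}"

definition diff_op :: "real \<Rightarrow> (real \<Rightarrow> 'a::banach) \<Rightarrow> real \<Rightarrow> 'a" where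
  "diff_op h \<phi> = (\<lambda>t. \<phi> (t + h) - \<phi> t)"

definition mean_op :: "real \<Rightarrow> (real \<Rightarrow> 'a::banach) \<Rightarrow> real \<Rightarrow> 'a" where
  "mean_op h \<phi> = (\<lambda>t. (1 / h) *\<^sub>R Bochner_integral (lebesgue_on {0..h}) (\<lambda>s. \<phi> (t + s)))"

definition satisfies_Delta :: "real set \<Rightarrow> (real \<Rightarrow> 'a::banach) set \<Rightarrow> bool" where
  "satisfies_Delta J \<A> \<longleftrightarrow>
     (\<forall>\<phi>\<in>L1_loc J. (\<forall>s>0. diff_op s \<phi> \<in> \<A>) \<longrightarrow> (\<forall>h>0. (\<lambda>t. \<phi> t - mean_op h \<phi> t) \<in> \<A>))"

end

theory Submission
  imports Defs
begin

text \<open>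
The mean satisfies \<open>\<phi> - M\<^sub>h \<phi> = - (1/h) \<integral>\<^sub>0\<^sup>h \<Delta>\<^sub>s \<phi> ds\<close>. Each of the four classes consists of the locally
integrable \<open>f\<close> for which \<open>q x (x + T) f / T\<close> tends to \<open>0\<close> as \<open>T \<rightarrow> \<infinity>\<close>, uniformly for \<open>x\<close> in a set \<open>I\<close>. Here
\<open>q a b f\<close> is one of the two seminorms \<open>\<parallel>\<integral>\<^sub>a\<^sup>b f\<parallel>\<close> and \<open>\<integral>\<^sub>a\<^sup>b \<parallel>f\<parallel>\<close>, and \<open>I\<close> is either all of \<open>J\<close> (ergodic classes)
or the single point \<open>alpha0 J\<close> (Cesaro classes). So it is enough to bound \<open>q x (x + T) (\<Delta>\<^sub>s \<phi>) / T\<close>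
uniformly in \<open>s \<in> [0, h]\<close>, whereas the hypothesis gives convergence for each \<open>s\<close> separately.

Uniformity comes from Baire's theorem. Fix \<open>\<epsilon> > 0\<close> and let \<open>S n\<close> be the set of all \<open>s \<ge> 0\<close> such that
\<open>q x (x + T) (\<Delta>\<^sub>s \<phi>) \<le> \<epsilon> T\<close> for all \<open>T \<ge> n + 1\<close> and \<open>x \<in> I\<close>. The sets \<open>S n\<close> are closed, because translation
is continuous in \<open>L\<^sup>1\<close>, and they cover the half-line, so one of them contains an interval \<open>[a, a + d]\<close>. The
identity \<open>\<Delta>\<^sub>u \<phi> = \<Delta>\<^bsub>a+u\<^esub> \<phi> - (\<Delta>\<^sub>a \<phi>)(\<cdot> + u)\<close> moves the bound from \<open>[a, a + d]\<close> to \<open>[0, d]\<close>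
(\<open>diff_op_uniformly_small_near_zero\<close>). Finitely many translates of \<open>[0, d]\<close> cover \<open>[0, h]\<close>, and
\<open>\<Delta>\<^bsub>r+u\<^esub> \<phi> = (\<Delta>\<^sub>r \<phi>)(\<cdot> + u) + \<Delta>\<^sub>u \<phi>\<close> extends the bound to \<open>[0, h]\<close> (\<open>diff_op_uniformly_small\<close>). Both steps
need the convergence for a fixed function to be uniform under translations by \<open>u \<in> [0, d]\<close>
(\<open>null_mean_translate_uniform\<close>).

The passage from \<open>\<Delta>\<^sub>s \<phi>\<close> to \<open>\<phi> - M\<^sub>h \<phi>\<close> (\<open>diff_mean_op_le\<close>) avoids vector-valued Fubini theorems: on a bounded
interval \<open>\<phi> - M\<^sub>h \<phi>\<close> is an \<open>L\<^sup>1\<close> limit of the averages \<open>-(1/n) \<Sum>\<^bsub>i<n\<^esub> \<Delta>\<^bsub>ih/n\<^esub> \<phi>\<close>, so that any seminorm dominated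
by the \<open>L\<^sup>1\<close> norm can be estimated by convexity.

The space \<open>X\<close> need not be separable. All measure theory is therefore reduced to one fact: a function
on \<open>[a, b]\<close> is Bochner integrable if and only if it can be approximated in the mean by continuous functions,
and its Bochner integral is then its Henstock-Kurzweil integral
(\<open>Bochner_integrable_iff_cont_approximable\<close>, \<open>Bochner_integral_eq_integral\<close>).
\<close>

section \<open>Approximation in the mean by continuous functions\<close>

text \<open>The error is controlled by an integrable majorant \<open>k\<close> and not by the integral of \<open>norm (f t - g t)\<close>
itself. In this form the property is visibly stable under linear operations, norms and translations, since
no measurability has to be checked; that \<open>norm (f t - g t)\<close> is integrable follows in the end
(\<open>cont_approximable_obtain\<close>).\<close>
definition cont_approximable :: "real \<Rightarrow> real \<Rightarrow> (real \<Rightarrow> 'a::banach) \<Rightarrow> bool" where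
  "cont_approximable a b f \<longleftrightarrow>
     (\<forall>e>0. \<exists>g k. continuous_on {a..b} g \<and> k integrable_on {a..b} \<and>
        (\<forall>t\<in>{a..b}. norm (f t - g t) \<le> k t) \<and> integral {a..b} k < e)"

lemma cont_approximableE:
  assumes "cont_approximable a b f" "0 < e"
  obtains g k where "continuous_on {a..b} g" "k integrable_on {a..b}"
    "\<And>t. t \<in> {a..b} \<Longrightarrow> norm (f t - g t) \<le> k t" "integral {a..b} k < e"
  using assms unfolding cont_approximable_def by meson

lemma cont_approximable_continuous: "continuous_on {a..b} f \<Longrightarrow> cont_approximable a b f"
  unfolding cont_approximable_def
  by (intro allI impI exI[of _ f] exI[of _ "\<lambda>_. 0"]) auto

lemma cont_approximable_limit:
  fixes f :: "real \<Rightarrow> 'a::banach"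
  assumes "\<And>e. 0 < e \<Longrightarrow> \<exists>g k. cont_approximable a b g \<and> k integrable_on {a..b} \<and>
        (\<forall>t\<in>{a..b}. norm (f t - g t) \<le> k t) \<and> integral {a..b} k < e"
  shows "cont_approximable a b f"
  unfolding cont_approximable_def
proof (intro allI impI)
  fix e :: real assume "0 < e"
  then have e: "0 < e/2" by simp
  from assms[OF this] obtain g k where g: "cont_approximable a b g" "k integrable_on {a..b}"
    "\<forall>t\<in>{a..b}. norm (f t - g t) \<le> k t" "integral {a..b} k < e/2" by blast
  from cont_approximableE[OF g(1) e] obtain g' k' where g': "continuous_on {a..b} g'"
    "k' integrable_on {a..b}" "\<And>t. t \<in> {a..b} \<Longrightarrow> norm (g t - g' t) \<le> k' t"
    "integral {a..b} k' < e/2" by blast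
  show "\<exists>g k. continuous_on {a..b} g \<and> k integrable_on {a..b} \<and>
        (\<forall>t\<in>{a..b}. norm (f t - g t) \<le> k t) \<and> integral {a..b} k < e"
  proof (intro exI conjI ballI)
    show "continuous_on {a..b} g'" by fact
    show "(\<lambda>t. k t + k' t) integrable_on {a..b}" using g g' by (intro integrable_add)
    show "integral {a..b} (\<lambda>t. k t + k' t) < e"
      using g g' by (simp add: integral_add)
    fix t assume t: "t \<in> {a..b}"
    have "norm (f t - g' t) \<le> norm (f t - g t) + norm (g t - g' t)"
      using norm_triangle_ineq[of "f t - g t" "g t - g' t"] by simp
    then show "norm (f t - g' t) \<le> k t + k' t" using g(3) g'(3)[OF t] t by fastforce
  qed
qed

lemma cont_approximable_add:
  assumes "cont_approximable a b f" "cont_approximable a b g"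
  shows "cont_approximable a b (\<lambda>t. f t + g t)"
  unfolding cont_approximable_def
proof (intro allI impI)
  fix e :: real assume "0 < e"
  then have e: "0 < e/2" by simp
  from cont_approximableE[OF assms(1) e] obtain f' k where f': "continuous_on {a..b} f'"
    "k integrable_on {a..b}" "\<And>t. t \<in> {a..b} \<Longrightarrow> norm (f t - f' t) \<le> k t"
    "integral {a..b} k < e/2" by blast
  from cont_approximableE[OF assms(2) e] obtain g' k' where g': "continuous_on {a..b} g'"
    "k' integrable_on {a..b}" "\<And>t. t \<in> {a..b} \<Longrightarrow> norm (g t - g' t) \<le> k' t"
    "integral {a..b} k' < e/2" by blast
  show "\<exists>h k. continuous_on {a..b} h \<and> k integrable_on {a..b} \<and>
        (\<forall>t\<in>{a..b}. norm (f t + g t - h t) \<le> k t) \<and> integral {a..b} k < e"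
  proof (intro exI conjI ballI)
    show "continuous_on {a..b} (\<lambda>t. f' t + g' t)" by (intro continuous_intros f' g')
    show "(\<lambda>t. k t + k' t) integrable_on {a..b}" using f' g' by (intro integrable_add)
    show "integral {a..b} (\<lambda>t. k t + k' t) < e"
      using f' g' by (simp add: integral_add)
    fix t assume t: "t \<in> {a..b}"
    show "norm (f t + g t - (f' t + g' t)) \<le> k t + k' t"
      using f'(3)[OF t] g'(3)[OF t] norm_diff_triangle_ineq[of "f t" "g t" "f' t" "g' t"]
      by linarith
  qed
qed

lemma cont_approximable_bounded_linear:
  assumes "bounded_linear L" "cont_approximable a b f"
  shows "cont_approximable a b (\<lambda>t. L (f t))"
proof -
  interpret L: bounded_linear L by fact
  obtain B where B: "0 < B" "\<And>x. norm (L x) \<le> norm x * B" using L.pos_bounded by blast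
  show ?thesis unfolding cont_approximable_def
  proof (intro allI impI)
    fix e :: real assume "0 < e"
    then have "0 < e/B" using B by simp
    from cont_approximableE[OF assms(2) this] obtain f' k where f': "continuous_on {a..b} f'"
      "k integrable_on {a..b}" "\<And>t. t \<in> {a..b} \<Longrightarrow> norm (f t - f' t) \<le> k t"
      "integral {a..b} k < e/B" by blast
    show "\<exists>h k. continuous_on {a..b} h \<and> k integrable_on {a..b} \<and>
        (\<forall>t\<in>{a..b}. norm (L (f t) - h t) \<le> k t) \<and> integral {a..b} k < e"
    proof (intro exI conjI ballI)
      show "continuous_on {a..b} (\<lambda>t. L (f' t))" by (intro L.continuous_on f')
      show "(\<lambda>t. k t * B) integrable_on {a..b}"
        using f' by (intro integrable_on_mult_left)
      show "integral {a..b} (\<lambda>t. k t * B) < e"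
        using f'(4) B by (simp add: field_simps)
      fix t assume t: "t \<in> {a..b}"
      show "norm (L (f t) - L (f' t)) \<le> k t * B"
        using f'(3)[OF t] B(2)[of "f t - f' t"] B(1)
        by (simp add: L.diff) (meson mult_right_mono less_imp_le order_trans)
    qed
  qed
qed

lemmas cont_approximable_scaleR = cont_approximable_bounded_linear[OF bounded_linear_scaleR_right]

lemma cont_approximable_diff:
  assumes "cont_approximable a b f" "cont_approximable a b g"
  shows "cont_approximable a b (\<lambda>t. f t - g t)"
  using cont_approximable_add[OF assms(1) cont_approximable_scaleR[OF assms(2), of "-1"]] by simp

lemma cont_approximable_sum:
  assumes "\<And>i. i \<in> A \<Longrightarrow> cont_approximable a b (f i)"
  shows "cont_approximable a b (\<lambda>t. \<Sum>i\<in>A. f i t)"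
  using assms
  by (induction A rule: infinite_finite_induct)
     (auto intro: cont_approximable_add cont_approximable_continuous)

lemma cont_approximable_norm:
  assumes "cont_approximable a b f"
  shows "cont_approximable a b (\<lambda>t. norm (f t))"
  unfolding cont_approximable_def
proof (intro allI impI)
  fix e :: real assume "0 < e"
  from cont_approximableE[OF assms this] obtain g k where g: "continuous_on {a..b} g"
    "k integrable_on {a..b}" "\<And>t. t \<in> {a..b} \<Longrightarrow> norm (f t - g t) \<le> k t"
    "integral {a..b} k < e" by blast
  show "\<exists>g k. continuous_on {a..b} g \<and> k integrable_on {a..b} \<and>
        (\<forall>t\<in>{a..b}. norm (norm (f t) - g t) \<le> k t) \<and> integral {a..b} k < e"
  proof (intro exI conjI ballI)
    show "continuous_on {a..b} (\<lambda>t. norm (g t))" by (intro continuous_intros g)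
    show "norm (norm (f t) - norm (g t)) \<le> k t" if "t \<in> {a..b}" for t
      using g(3)[OF that] norm_triangle_ineq3[of "f t" "g t"] by simp
  qed (use g in auto)
qed

lemma cont_approximable_cong:
  assumes "\<And>t. t \<in> {a..b} \<Longrightarrow> f t = g t" "cont_approximable a b f"
  shows "cont_approximable a b g"
  by (rule cont_approximable_limit, rule exI[of _ f], rule exI[of _ "\<lambda>_. 0"]) (use assms in auto)

lemma nonneg_integrable_subinterval:
  fixes k :: "real \<Rightarrow> real"
  assumes "k integrable_on {a..b}" "\<And>t. t \<in> {a..b} \<Longrightarrow> 0 \<le> k t" "{c..d} \<subseteq> {a..b}"
  shows "k integrable_on {c..d}" "integral {c..d} k \<le> integral {a..b} k"
proof -
  show i: "k integrable_on {c..d}"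
    using assms integrable_on_subinterval by blast
  show "integral {c..d} k \<le> integral {a..b} k"
    using assms by (intro integral_subset_le i) auto
qed

lemma cont_approximable_subinterval:
  assumes "cont_approximable a b f" "{c..d} \<subseteq> {a..b}"
  shows "cont_approximable c d f"
  unfolding cont_approximable_def
proof (intro allI impI)
  fix e :: real assume "0 < e"
  from cont_approximableE[OF assms(1) this] obtain g k where g: "continuous_on {a..b} g"
    "k integrable_on {a..b}" "\<And>t. t \<in> {a..b} \<Longrightarrow> norm (f t - g t) \<le> k t"
    "integral {a..b} k < e" by blast
  have "0 \<le> k t" if "t \<in> {a..b}" for t using g(3)[OF that] norm_ge_zero order_trans by blast
  from nonneg_integrable_subinterval[OF g(2) this assms(2)]
  show "\<exists>g k. continuous_on {c..d} g \<and> k integrable_on {c..d} \<and>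
        (\<forall>t\<in>{c..d}. norm (f t - g t) \<le> k t) \<and> integral {c..d} k < e"
    using g assms(2) by (intro exI[of _ g] exI[of _ k]) (auto intro: continuous_on_subset)
qed

lemma has_integral_translate:
  "((\<lambda>t. f (t + u)) has_integral y) {a..b} \<longleftrightarrow> (f has_integral y) {a + u..b + u::real}"
  using has_integral_shift_Icc_real[of f u y a b] by (simp add: o_def add.commute)

lemma integrable_translate:
  "(\<lambda>t. f (t + u)) integrable_on {a..b} \<longleftrightarrow> f integrable_on {a + u..b + u::real}"
  by (simp add: integrable_on_def has_integral_translate)

lemma integral_translate:
  "integral {a..b} (\<lambda>t. f (t + u)) = integral {a + u..b + u::real} f"
  unfolding integral_def by (simp add: integrable_translate has_integral_translate)

lemma cont_approximable_translate:
  assumes "cont_approximable (a + u) (b + u) f"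
  shows "cont_approximable a b (\<lambda>t. f (t + u))"
  unfolding cont_approximable_def
proof (intro allI impI)
  fix e :: real assume "0 < e"
  from cont_approximableE[OF assms(1) this] obtain g k where g: "continuous_on {a+u..b+u} g"
    "k integrable_on {a+u..b+u}" "\<And>t. t \<in> {a+u..b+u} \<Longrightarrow> norm (f t - g t) \<le> k t"
    "integral {a+u..b+u} k < e" by blast
  show "\<exists>g k. continuous_on {a..b} g \<and> k integrable_on {a..b} \<and>
        (\<forall>t\<in>{a..b}. norm (f (t + u) - g t) \<le> k t) \<and> integral {a..b} k < e"
  proof (intro exI conjI ballI)
    show "continuous_on {a..b} (\<lambda>t. g (t + u))"
      by (rule continuous_on_compose2[OF g(1)]) (auto intro: continuous_intros)
    show "(\<lambda>t. k (t + u)) integrable_on {a..b}" using g by (simp add: integrable_translate)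
    show "integral {a..b} (\<lambda>t. k (t + u)) < e" using g by (simp add: integral_translate)
  qed (use g(3) in auto)
qed

text \<open>The weight is the length of the interval, spelled as a measure because \<open>content\<close> is ambiguous with
the content of a polynomial.\<close>
abbreviation riemann_sum :: "(real \<Rightarrow> 'a::real_normed_vector) \<Rightarrow> (real \<times> real set) set \<Rightarrow> 'a" where
  "riemann_sum f D \<equiv> \<Sum>(x, K)\<in>D. measure lborel K *\<^sub>R f x"

text \<open>Two Riemann sums of \<open>f\<close> differ by little: the sums of the continuous approximant \<open>g\<close> satisfy the Cauchy
criterion, and the sums of \<open>f - g\<close> are bounded by those of \<open>k\<close>, hence by about the integral of \<open>k\<close>.\<close>
lemma cont_approximable_integrable:
  assumes "cont_approximable a b f"
  shows "f integrable_on {a..b}"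
proof -
  have "\<exists>\<gamma>. gauge \<gamma> \<and> (\<forall>\<D>1 \<D>2. \<D>1 tagged_division_of cbox a b \<and> \<gamma> fine \<D>1 \<and>
            \<D>2 tagged_division_of cbox a b \<and> \<gamma> fine \<D>2 \<longrightarrow> norm (riemann_sum f \<D>1 - riemann_sum f \<D>2) < e)"
    if "0 < e" for e :: real
  proof -
    have e: "0 < e/5" using that by simp
    from cont_approximableE[OF assms e] obtain g k where g: "continuous_on {a..b} g"
      "k integrable_on {a..b}" "\<And>t. t \<in> {a..b} \<Longrightarrow> norm (f t - g t) \<le> k t"
      "integral {a..b} k < e/5" by blast
    have "g integrable_on cbox a b" using integrable_continuous_real[OF g(1)] by simp
    then obtain \<gamma>1 where \<gamma>1: "gauge \<gamma>1"
      "\<And>D1 D2. D1 tagged_division_of cbox a b \<Longrightarrow> \<gamma>1 fine D1 \<Longrightarrow>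
          D2 tagged_division_of cbox a b \<Longrightarrow> \<gamma>1 fine D2 \<Longrightarrow> norm (riemann_sum g D1 - riemann_sum g D2) < e/5"
      unfolding integrable_Cauchy using e by meson
    have "(k has_integral integral {a..b} k) (cbox a b)" using integrable_integral[OF g(2)] by simp
    then obtain \<gamma>2 where \<gamma>2: "gauge \<gamma>2"
      "\<And>D. D tagged_division_of cbox a b \<Longrightarrow> \<gamma>2 fine D \<Longrightarrow> norm (riemann_sum k D - integral {a..b} k) < e/5"
      unfolding has_integral using e by meson
    have near: "norm (riemann_sum f D - riemann_sum g D) < 2 * (e/5)"
      if D: "D tagged_division_of cbox a b" "\<gamma>2 fine D" for D
    proof -
      have "riemann_sum f D - riemann_sum g D = riemann_sum (\<lambda>x. f x - g x) D"
        by (simp add: sum_subtractf[symmetric] split_def scaleR_diff_right)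
      also have "norm \<dots> \<le> riemann_sum k D"
      proof (rule sum_norm_le)
        fix z assume z: "z \<in> D"
        obtain x K where xK: "z = (x, K)" by (cases z)
        have "x \<in> {a..b}" using D(1) z xK tagged_division_ofD(2,3)[OF D(1), of x K] by auto
        from g(3)[OF this]
        show "norm (case z of (x, K) \<Rightarrow> measure lborel K *\<^sub>R (f x - g x))
              \<le> (case z of (x, K) \<Rightarrow> measure lborel K *\<^sub>R k x)"
          using xK by (simp add: mult_left_mono)
      qed
      also have "\<dots> < 2 * (e/5)"
      proof -
        have "riemann_sum k D - integral {a..b} k < e/5"
          by (rule order.strict_trans1[OF abs_ge_self \<gamma>2(2)[OF D, unfolded real_norm_def]])
        then show ?thesis using g(4) by linarith
      qed
      finally show ?thesis .
    qed
    show ?thesis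
    proof (intro exI[of _ "\<lambda>x. \<gamma>1 x \<inter> \<gamma>2 x"] conjI allI impI)
      show "gauge (\<lambda>x. \<gamma>1 x \<inter> \<gamma>2 x)" using \<gamma>1 \<gamma>2 by (simp add: gauge_Int)
      fix D1 D2 assume "D1 tagged_division_of cbox a b \<and> (\<lambda>x. \<gamma>1 x \<inter> \<gamma>2 x) fine D1 \<and>
         D2 tagged_division_of cbox a b \<and> (\<lambda>x. \<gamma>1 x \<inter> \<gamma>2 x) fine D2"
      then have D: "D1 tagged_division_of cbox a b" "\<gamma>1 fine D1" "\<gamma>2 fine D1"
         "D2 tagged_division_of cbox a b" "\<gamma>1 fine D2" "\<gamma>2 fine D2" by (auto simp: fine_Int)
      have tri: "norm (u - v) \<le> norm (u - u') + norm (u' - v') + norm (v - v')" for u v u' v' :: 'a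
        using norm_triangle_ineq[of "u - u'" "u' - v'"] norm_triangle_ineq4[of "u - v'" "v - v'"] by simp
      then show "norm (riemann_sum f D1 - riemann_sum f D2) < e"
        using tri[of "riemann_sum f D1" "riemann_sum f D2" "riemann_sum g D1" "riemann_sum g D2"]
          near[OF D(1,3)] near[OF D(4,6)] \<gamma>1(2)[OF D(1,2,4,5)] by linarith
    qed
  qed
  then have "f integrable_on cbox a b" unfolding integrable_Cauchy by blast
  then show ?thesis by simp
qed

lemma cont_approximable_norm_integrable:
  "cont_approximable a b f \<Longrightarrow> (\<lambda>t. norm (f t)) integrable_on {a..b}"
  by (intro cont_approximable_integrable cont_approximable_norm)

lemma cont_approximable_norm_integral_le:
  "cont_approximable a b f \<Longrightarrow> norm (integral {a..b} f) \<le> integral {a..b} (\<lambda>t. norm (f t))"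
  by (intro integral_norm_bound_integral cont_approximable_integrable
       cont_approximable_norm_integrable) auto

text \<open>Now that \<open>norm (f t - g t)\<close> is known to be integrable, the majorant can be dropped.\<close>
lemma cont_approximable_obtain:
  assumes "cont_approximable a b f" "0 < e"
  obtains g where "continuous_on {a..b} g" "cont_approximable a b (\<lambda>t. f t - g t)"
    "integral {a..b} (\<lambda>t. norm (f t - g t)) < e"
proof -
  from cont_approximableE[OF assms] obtain g k where g: "continuous_on {a..b} g"
    "k integrable_on {a..b}" "\<And>t. t \<in> {a..b} \<Longrightarrow> norm (f t - g t) \<le> k t"
    "integral {a..b} k < e" by blast
  have *: "cont_approximable a b (\<lambda>t. f t - g t)"
    by (rule cont_approximable_diff[OF assms(1) cont_approximable_continuous[OF g(1)]])
  have "integral {a..b} (\<lambda>t. norm (f t - g t)) \<le> integral {a..b} k"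
    using g by (intro integral_le cont_approximable_norm_integrable *) auto
  with g(4) have "integral {a..b} (\<lambda>t. norm (f t - g t)) < e" by simp
  from that[OF g(1) * this] show thesis .
qed

section \<open>Bochner integrability as approximability\<close>

text \<open>Regularity of Lebesgue measure encloses \<open>A\<close> between a closed \<open>K\<close> and an open \<open>U\<close>. A Urysohn function that
is \<open>1\<close> on \<open>K\<close> and \<open>0\<close> off \<open>U\<close> differs from the indicator of \<open>A\<close> only on the small set \<open>U - K\<close>.\<close>
lemma cont_approximable_indicator:
  assumes "A \<in> sets lebesgue"
  shows "cont_approximable a b (indicat_real A)"
  unfolding cont_approximable_def
proof (intro allI impI)
  fix e :: real assume "0 < e"
  then have e: "0 < e/2" by simp
  obtain K where K: "closed K" "K \<subseteq> A" "A - K \<in> lmeasurable" "emeasure lebesgue (A - K) < ennreal (e/2)"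
    using sets_lebesgue_inner_closed[OF assms e] by blast
  obtain U where U: "open U" "A \<subseteq> U" "U - A \<in> lmeasurable" "emeasure lebesgue (U - A) < ennreal (e/2)"
    using sets_lebesgue_outer_open[OF assms e] by blast
  define N where "N = (A - K) \<union> (U - A)"
  have N: "N \<in> lmeasurable" using K U by (auto simp: N_def)
  have "measure lebesgue N \<le> measure lebesgue (A - K) + measure lebesgue (U - A)"
    unfolding N_def using K U by (intro measure_Un_le) auto
  moreover have "measure lebesgue (A - K) < e/2"
    using K(3,4) e by (simp add: emeasure_eq_measure2 ennreal_less_iff)
  moreover have "measure lebesgue (U - A) < e/2"
    using U(3,4) e by (simp add: emeasure_eq_measure2 ennreal_less_iff)
  ultimately have mN: "measure lebesgue N < e" by simp
  have "closed (- U)" "K \<inter> - U = {}" using U K by auto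
  then obtain g :: "real \<Rightarrow> real" where g: "continuous_on UNIV g"
    "\<And>x. g x \<in> closed_segment 1 0" "\<And>x. x \<in> K \<Longrightarrow> g x = 1" "\<And>x. x \<in> -U \<Longrightarrow> g x = 0"
  proof (rule Urysohn[OF K(1), of "- U" "1::real" 0])
    fix g :: "real \<Rightarrow> real"
    assume "continuous_on UNIV g" "\<And>x. g x \<in> closed_segment 1 0"
      "\<And>x. x \<in> K \<Longrightarrow> g x = 1" "\<And>x. x \<in> - U \<Longrightarrow> g x = 0"
    then show thesis by (rule that)
  qed
  have g01: "0 \<le> g x \<and> g x \<le> 1" for x
    using g(2)[of x] by (simp add: closed_segment_eq_real_ivl)
  have NI: "N \<inter> {a..b} \<in> lmeasurable" using N by (intro fmeasurable.Int) auto
  show "\<exists>g k. continuous_on {a..b} g \<and> k integrable_on {a..b} \<and>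
        (\<forall>t\<in>{a..b}. norm (indicat_real A t - g t) \<le> k t) \<and> integral {a..b} k < e"
  proof (intro exI conjI ballI)
    show "continuous_on {a..b} g" using g(1) continuous_on_subset by blast
    show "indicat_real N integrable_on {a..b}" using NI by (simp add: integrable_on_indicator)
    have "integral {a..b} (indicat_real N) = measure lebesgue (N \<inter> {a..b})"
      using NI by (simp add: integral_indicator)
    also have "\<dots> \<le> measure lebesgue N"
      using N NI by (intro measure_mono_fmeasurable) auto
    finally show "integral {a..b} (indicat_real N) < e" using mN by simp
    fix t
    show "norm (indicat_real A t - g t) \<le> indicat_real N t"
      using g01[of t] g(3,4)[of t] K(2) U(2) by (auto simp: N_def indicator_def)
  qed
qed

lemma simple_function_lebesgue_on_sum:
  fixes s :: "real \<Rightarrow> 'a::real_vector"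
  assumes s: "simple_function (lebesgue_on S) s" and S: "S \<in> sets lebesgue"
  shows "finite (s ` S)" "\<And>y. {x \<in> S. s x = y} \<in> sets lebesgue"
    "\<And>x. x \<in> S \<Longrightarrow> (\<Sum>y\<in>s ` S. indicat_real {x \<in> S. s x = y} x *\<^sub>R y) = s x"
proof -
  have sp: "space (lebesgue_on S) = S" by (simp add: space_restrict_space)
  show fin: "finite (s ` S)" using simple_functionD(1)[OF s] sp by simp
  show "{x \<in> S. s x = y} \<in> sets lebesgue" for y
  proof -
    have "s -` {y} \<inter> S \<in> sets (lebesgue_on S)" using simple_functionD(2)[OF s, of "{y}"] sp by simp
    moreover have "s -` {y} \<inter> S = {x \<in> S. s x = y}" by auto
    ultimately show ?thesis using S by (simp add: sets_restrict_space_iff)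
  qed
  show "(\<Sum>y\<in>s ` S. indicat_real {x \<in> S. s x = y} x *\<^sub>R y) = s x" if "x \<in> S" for x
  proof -
    have "(\<Sum>y\<in>s ` S. indicat_real {x \<in> S. s x = y} x *\<^sub>R y)
        = (\<Sum>y\<in>s ` S. if y = s x then s x else 0)"
      using that by (intro sum.cong) (auto simp: indicator_def)
    also have "\<dots> = s x" using fin that by simp
    finally show ?thesis .
  qed
qed

lemma cont_approximable_simple_function:
  fixes s :: "real \<Rightarrow> 'a::banach"
  assumes "simple_function (lebesgue_on {a..b}) s"
  shows "cont_approximable a b s"
proof -
  note s = simple_function_lebesgue_on_sum[OF assms]
  have S: "{a..b} \<in> sets lebesgue" by simp
  show ?thesis
  proof (rule cont_approximable_cong)
    show "cont_approximable a b (\<lambda>x. \<Sum>y\<in>s ` {a..b}. indicat_real {x \<in> {a..b}. s x = y} x *\<^sub>R y)"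
      using s(2) S
      by (intro cont_approximable_sum cont_approximable_bounded_linear[OF bounded_linear_scaleR_left]
           cont_approximable_indicator) blast
  qed (use s(3) S in auto)
qed

lemma has_integral_simple_bochner_integral:
  fixes s :: "real \<Rightarrow> 'a::banach"
  assumes sf: "simple_function (lebesgue_on S) s" and S: "S \<in> lmeasurable"
  shows "(s has_integral Bochner_Integration.simple_bochner_integral (lebesgue_on S) s) S"
proof -
  have SL: "S \<in> sets lebesgue" using S by auto
  note s = simple_function_lebesgue_on_sum[OF sf SL]
  have sp: "space (lebesgue_on S) = S" by (simp add: space_restrict_space)
  have "((\<lambda>x. \<Sum>y\<in>s ` S. indicat_real {x \<in> S. s x = y} x *\<^sub>R y) has_integral
        (\<Sum>y\<in>s ` S. measure lebesgue {x \<in> S. s x = y} *\<^sub>R y)) S"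
  proof (intro has_integral_sum has_integral_scaleR_left)
    fix y
    have m: "{x \<in> S. s x = y} \<in> lmeasurable"
      using s(2) S by (intro fmeasurableI2[OF S]) auto
    then have "(indicat_real {x \<in> S. s x = y} has_integral measure lebesgue {x \<in> S. s x = y}) UNIV"
      by (simp add: lmeasurable_iff_has_integral)
    then have "((\<lambda>x. if x \<in> S then indicat_real {x \<in> S. s x = y} x else 0) has_integral
          measure lebesgue {x \<in> S. s x = y}) UNIV"
      by (rule has_integral_eq[rotated]) (auto simp: indicator_def)
    then show "(indicat_real {x \<in> S. s x = y} has_integral measure lebesgue {x \<in> S. s x = y}) S"
      by (simp only: has_integral_restrict_UNIV)
  qed (use s(1) in auto)
  also have "(\<Sum>y\<in>s ` S. measure lebesgue {x \<in> S. s x = y} *\<^sub>R y)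
      = Bochner_Integration.simple_bochner_integral (lebesgue_on S) s"
    unfolding simple_bochner_integral_def sp
    using SL by (intro sum.cong) (auto simp: measure_restrict_space)
  finally show ?thesis
    by (rule has_integral_eq[rotated]) (use s(3) in auto)
qed

text \<open>A term \<open>s i\<close> far along the sequence of simple functions in the definition of the Bochner integral is
approximable, and \<open>norm (f x - s i x)\<close> itself serves as the majorant.\<close>
lemma Bochner_imp_cont_approximable:
  fixes f :: "real \<Rightarrow> 'a::banach"
  assumes "Bochner_integrable (lebesgue_on {a..b}) f"
  shows "cont_approximable a b f"
proof (rule cont_approximable_limit)
  fix e :: real assume e: "0 < e"
  let ?M = "lebesgue_on {a..b}"
  have S: "{a..b} \<in> sets lebesgue" by simp
  obtain s where sm: "strongly_measurable ?M f"
    and s: "\<And>i. Bochner_Integration.simple_bochner_integrable ?M (s i)"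
      "(\<lambda>i::nat. \<integral>\<^sup>+x. norm (f x - s i x) \<partial>?M) \<longlonglongrightarrow> 0"
    using assms unfolding Bochner_integrable_def has_Bochner_def by auto
  have "\<forall>\<^sub>F i in sequentially. (\<integral>\<^sup>+x. norm (f x - s i x) \<partial>?M) < ennreal e"
    using order_tendstoD(2)[OF s(2)] e by simp
  then obtain i where i: "(\<integral>\<^sup>+x. norm (f x - s i x) \<partial>?M) < ennreal e"
    by (auto simp: eventually_sequentially)
  have sf: "simple_function ?M (s i)"
    using s(1)[of i] by (simp add: simple_bochner_integrable.simps)
  let ?k = "\<lambda>x. norm (f x - s i x)"
  have "?k \<in> borel_measurable ?M"
    by (rule strongly_measurable_norm_diff[OF complete_measure_lebesgue_on[OF S] sm sf])
  moreover have "(\<integral>\<^sup>+x. ennreal (norm (?k x)) \<partial>?M) < \<infinity>"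
    using i by (simp add: order.strict_trans)
  ultimately have int: "integrable ?M ?k" by (rule integrableI_bounded)
  have "ennreal (integral {a..b} ?k) = (\<integral>\<^sup>+x. ?k x \<partial>?M)"
    using nn_integral_eq_integral[OF int] lebesgue_integral_eq_integral[OF int S] by simp
  then have "integral {a..b} ?k < e"
    using i integral_nonneg[OF integrable_on_lebesgue_on[OF int S]]
    by (metis ennreal_less_iff norm_ge_zero)
  then show "\<exists>g k. cont_approximable a b g \<and> k integrable_on {a..b} \<and>
        (\<forall>t\<in>{a..b}. norm (f t - g t) \<le> k t) \<and> integral {a..b} k < e"
    using integrable_on_lebesgue_on[OF int S] cont_approximable_simple_function[OF sf]
    by (intro exI[of _ "s i"] exI[of _ ?k]) auto
qed

text \<open>The simple function is \<open>g\<close> evaluated at the largest grid point below \<open>x\<close>. The interval is compact, so only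
finitely many grid points occur.\<close>
lemma continuous_simple_function_approximation:
  fixes g :: "real \<Rightarrow> 'a::real_normed_vector"
  assumes "continuous_on {a..b} g" "0 < e"
  obtains t where "\<And>S. S \<subseteq> {a..b} \<Longrightarrow> S \<in> sets lebesgue \<Longrightarrow> simple_function (lebesgue_on S) t"
    "\<And>x. x \<in> {a..b} \<Longrightarrow> norm (g x - t x) \<le> e"
proof -
  have "uniformly_continuous_on {a..b} g"
    using assms(1) by (intro compact_uniformly_continuous) auto
  then obtain d where d: "0 < d"
    "\<And>x y. x \<in> {a..b} \<Longrightarrow> y \<in> {a..b} \<Longrightarrow> dist y x < d \<Longrightarrow> dist (g y) (g x) < e"
    unfolding uniformly_continuous_on_def using assms(2) by meson
  define h where "h = d/2"
  have h: "0 < h" "h < d" using d(1) by (auto simp: h_def)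
  \<comment> \<open>The first grid point may lie to the left of \<open>a\<close>, where \<open>g\<close> is uncontrolled.\<close>
  define t where "t = (\<lambda>x. g (max a (h * real_of_int \<lfloor>x / h\<rfloor>)))"
  show thesis
  proof
    fix S :: "real set" assume S: "S \<subseteq> {a..b}" "S \<in> sets lebesgue"
    have "(\<lambda>x. \<lfloor>x / h\<rfloor>) \<in> measurable (lebesgue_on S) (count_space UNIV)"
    proof (rule measurable_restrict_space1, rule measurable_completion)
      show "(\<lambda>x. \<lfloor>x / h\<rfloor>) \<in> measurable lborel (count_space UNIV)" by measurable
    qed
    moreover have "(\<lambda>x. \<lfloor>x / h\<rfloor>) ` space (lebesgue_on S) \<subseteq> {\<lfloor>a / h\<rfloor>..\<lfloor>b / h\<rfloor>}"
      using S(1) h by (fastforce simp: space_restrict_space intro!: floor_mono divide_right_mono)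
    ultimately have "simple_function (lebesgue_on S) (\<lambda>x. \<lfloor>x / h\<rfloor>)"
      by (auto simp: simple_function_eq_measurable intro: finite_subset)
    from simple_function_compose1[OF this, of "\<lambda>j. g (max a (h * real_of_int j))"]
    show "simple_function (lebesgue_on S) t" by (simp add: t_def)
  next
    fix x assume x: "x \<in> {a..b}"
    have "h * real_of_int \<lfloor>x / h\<rfloor> \<le> h * (x / h)" "h * (x / h) < h * (real_of_int \<lfloor>x / h\<rfloor> + 1)"
      using h by (intro mult_left_mono mult_strict_left_mono; linarith)+
    then have "h * real_of_int \<lfloor>x / h\<rfloor> \<le> x" "x < h * real_of_int \<lfloor>x / h\<rfloor> + h"
      using h by (simp_all add: algebra_simps)
    then have "dist (g x) (t x) < e"
      unfolding t_def using x h by (intro d(2)) (auto simp: dist_real_def)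
    then show "norm (g x - t x) \<le> e" by (simp add: dist_norm)
  qed
qed

text \<open>A product of approximable functions need not be approximable, but here one factor is an indicator. The
approximant \<open>c *\<^sub>R g\<close> works once \<open>c\<close> is chosen after \<open>g\<close>, with an error small compared with the bound of \<open>g\<close>.\<close>
lemma cont_approximable_restrict:
  assumes f: "cont_approximable a b f" and S: "S \<in> sets lebesgue"
  shows "cont_approximable a b (\<lambda>x. if x \<in> S then f x else 0)"
proof (rule cont_approximable_limit)
  fix e :: real assume "0 < e"
  then have e: "0 < e/2" by simp
  from cont_approximableE[OF f this] obtain g k where g: "continuous_on {a..b} g"
    "k integrable_on {a..b}" "\<And>t. t \<in> {a..b} \<Longrightarrow> norm (f t - g t) \<le> k t"
    "integral {a..b} k < e/2" by blast
  have k0: "0 \<le> k t" if "t \<in> {a..b}" for t using g(3)[OF that] norm_ge_zero order_trans by blast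
  have "bounded (g ` {a..b})" using g(1) by (simp add: compact_continuous_image compact_imp_bounded)
  then obtain B where B: "0 < B" "\<And>t. t \<in> {a..b} \<Longrightarrow> norm (g t) \<le> B"
    by (auto simp: bounded_pos)
  have "0 < e / 2 / B" using e B by simp
  from cont_approximableE[OF cont_approximable_indicator[OF S] this, of a b]
  obtain c l where c: "continuous_on {a..b} c"
    "l integrable_on {a..b}" "\<And>t. t \<in> {a..b} \<Longrightarrow> norm (indicat_real S t - c t) \<le> l t"
    "integral {a..b} l < e / 2 / B" by blast
  show "\<exists>g k. cont_approximable a b g \<and> k integrable_on {a..b} \<and>
        (\<forall>t\<in>{a..b}. norm ((if t \<in> S then f t else 0) - g t) \<le> k t) \<and> integral {a..b} k < e"
  proof (intro exI conjI ballI)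
    show "cont_approximable a b (\<lambda>t. c t *\<^sub>R g t)"
      using c g by (intro cont_approximable_continuous continuous_intros)
    have i: "(\<lambda>t. l t * B) integrable_on {a..b}" using c by (intro integrable_on_mult_left)
    then show "(\<lambda>t. k t + l t * B) integrable_on {a..b}" using g by (intro integrable_add)
    have "integral {a..b} l * B < e/2" using c(4) B by (simp add: field_simps)
    then show "integral {a..b} (\<lambda>t. k t + l t * B) < e"
      using i g by (simp add: integral_add)
    fix t assume t: "t \<in> {a..b}"
    have "(if t \<in> S then f t else 0) - c t *\<^sub>R g t
        = indicat_real S t *\<^sub>R (f t - g t) + (indicat_real S t - c t) *\<^sub>R g t"
      by (auto simp: algebra_simps)
    also have "norm \<dots> \<le> \<bar>indicat_real S t\<bar> * norm (f t - g t) + \<bar>indicat_real S t - c t\<bar> * norm (g t)"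
      by (rule order_trans[OF norm_triangle_ineq]) simp
    also have "\<dots> \<le> k t + l t * B"
    proof (rule add_mono)
      show "\<bar>indicat_real S t\<bar> * norm (f t - g t) \<le> k t"
        using g(3)[OF t] k0[OF t] by (auto simp: indicator_def)
      show "\<bar>indicat_real S t - c t\<bar> * norm (g t) \<le> l t * B"
        using c(3)[OF t] B(2)[OF t] by (intro mult_mono) auto
    qed
    finally show "norm ((if t \<in> S then f t else 0) - c t *\<^sub>R g t) \<le> k t + l t * B" .
  qed
qed

text \<open>Choosing the \<open>n\<close>-th simple approximant with a mean error of order \<open>2\<^sup>-\<^sup>n\<close> makes the errors summable. So the
majorants tend to \<open>0\<close> almost everywhere, which gives strong measurability, and the integrals of the simple
functions converge to the Henstock-Kurzweil integral of \<open>f\<close>. The set \<open>S\<close> is general because local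
integrability refers to all compact sets.\<close>
lemma cont_approximable_has_Bochner:
  fixes f :: "real \<Rightarrow> 'a::banach"
  assumes f: "cont_approximable a b f" and S: "S \<in> sets lebesgue" "S \<subseteq> {a..b}"
  shows "has_Bochner (lebesgue_on S) f (integral S f)"
proof -
  let ?M = "lebesgue_on S"
  have Slm: "S \<in> lmeasurable" by (rule fmeasurableI2[of "{a..b}"]) (use S in auto)
  have sp: "space ?M = S" by (simp add: space_restrict_space)
  \<comment> \<open>The mean error of the simple approximant is \<open>2\<^sup>-\<^sup>n\<close> from \<open>g\<close> and \<open>2\<^sup>-\<^sup>n (b - a)\<close> from discretising \<open>g\<close>.\<close>
  define C where "C = 1 + measure lborel {a..b}"
  have C: "0 < C" by (simp add: C_def add_pos_nonneg)
  have "\<exists>t k. simple_function ?M t \<and> k integrable_on {a..b} \<and>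
      (\<forall>x\<in>{a..b}. norm (f x - t x) \<le> k x) \<and> integral {a..b} k \<le> C * (1/2) ^ n" for n :: nat
  proof -
    have e: "(0::real) < (1/2) ^ n" by simp
    from cont_approximableE[OF f e] obtain g k where g: "continuous_on {a..b} g"
      "k integrable_on {a..b}" "\<And>t. t \<in> {a..b} \<Longrightarrow> norm (f t - g t) \<le> k t"
      "integral {a..b} k < (1/2) ^ n" by blast
    from continuous_simple_function_approximation[OF g(1) e] obtain t where t:
      "\<And>S. S \<subseteq> {a..b} \<Longrightarrow> S \<in> sets lebesgue \<Longrightarrow> simple_function (lebesgue_on S) t"
      "\<And>x. x \<in> {a..b} \<Longrightarrow> norm (g x - t x) \<le> (1/2) ^ n" by blast
    show ?thesis
    proof (intro exI conjI ballI)
      show "simple_function ?M t" using t(1) S by blast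
      have c: "((\<lambda>_. (1/2) ^ n) has_integral measure lborel {a..b} *\<^sub>R ((1/2) ^ n :: real)) {a..b}"
        using has_integral_const_real by blast
      then show i: "(\<lambda>x. k x + (1/2) ^ n) integrable_on {a..b}"
        using g(2) by (intro integrable_add) blast+
      have "integral {a..b} (\<lambda>x. k x + (1/2) ^ n)
          = integral {a..b} k + measure lborel {a..b} * (1/2) ^ n"
        using integral_unique[OF has_integral_add[OF integrable_integral[OF g(2)] c]] by simp
      then show "integral {a..b} (\<lambda>x. k x + (1/2) ^ n) \<le> C * (1/2) ^ n"
        using g(4) by (simp add: C_def algebra_simps)
      fix x assume x: "x \<in> {a..b}"
      show "norm (f x - t x) \<le> k x + (1/2) ^ n"
        using norm_triangle_ineq[of "f x - g x" "g x - t x"] g(3)[OF x] t(2)[OF x] by simp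
    qed
  qed
  then obtain t k where t: "\<And>n. simple_function ?M (t n)" and k: "\<And>n. k n integrable_on {a..b}"
    and tk: "\<And>n x. x \<in> {a..b} \<Longrightarrow> norm (f x - t n x) \<le> k n x"
    and kC: "\<And>n::nat. integral {a..b} (k n) \<le> C * (1/2) ^ n" by metis
  have k0: "0 \<le> k n x" if "x \<in> {a..b}" for n x
    using tk[OF that, of n] norm_ge_zero order_trans by blast
  have km: "k n \<in> borel_measurable ?M" for n
    using integrable_imp_measurable[OF k[of n]] S(2) by (rule measurable_restrict_mono)
  have kb: "(\<integral>\<^sup>+x. k n x \<partial>?M) \<le> ennreal (C * (1/2) ^ n)" for n
  proof -
    have "(\<integral>\<^sup>+x. k n x \<partial>?M) = (\<integral>\<^sup>+x. ennreal (k n x) * indicator S x \<partial>lborel)"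
      using S by (simp add: nn_integral_restrict_space nn_integral_completion)
    also have "\<dots> \<le> (\<integral>\<^sup>+x. ennreal (k n x) * indicator {a..b} x \<partial>lborel)"
      using S by (intro nn_integral_mono mult_left_mono) (auto simp: indicator_def)
    also have "\<dots> = ennreal (integral {a..b} (k n))"
      by (rule nn_integral_has_integral_lebesgue'[OF k0 integrable_integral[OF k]])
    finally show ?thesis using kC[of n] order_trans ennreal_leI by blast
  qed
  have "summable (\<lambda>n. C * (1/2) ^ n)" by (intro summable_mult summable_geometric) simp
  then have fin: "(\<Sum>n. ennreal (C * (1/2) ^ n)) \<noteq> top"
    using C by (intro ennreal_suminf_neq_top) auto
  have "(\<integral>\<^sup>+x. (\<Sum>n. ennreal (k n x)) \<partial>?M) = (\<Sum>n. \<integral>\<^sup>+x. k n x \<partial>?M)"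
    using km by (intro nn_integral_suminf) simp
  also have "\<dots> \<le> (\<Sum>n. ennreal (C * (1/2) ^ n))"
    using kb by (intro suminf_le) auto
  finally have "(\<integral>\<^sup>+x. (\<Sum>n. ennreal (k n x)) \<partial>?M) \<noteq> \<infinity>"
    using fin by (auto simp: top_unique)
  then have "AE x in ?M. (\<Sum>n. ennreal (k n x)) \<noteq> \<infinity>"
    using km by (intro nn_integral_PInf_AE) auto
  then have AE: "AE x in ?M. (\<lambda>n. t n x) \<longlonglongrightarrow> f x"
  proof (rule AE_mp, intro AE_I2 impI)
    fix x assume x: "x \<in> space ?M" "(\<Sum>n. ennreal (k n x)) \<noteq> \<infinity>"
    then have xab: "x \<in> {a..b}" using S sp by auto
    have "summable (\<lambda>n. k n x)"
      using x(2) k0[OF xab] by (intro summable_suminf_not_top) auto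
    then have "(\<lambda>n. k n x) \<longlonglongrightarrow> 0" by (rule summable_LIMSEQ_zero)
    then have "(\<lambda>n. f x - t n x) \<longlonglongrightarrow> 0"
      by (rule Lim_null_comparison[rotated]) (use tk[OF xab] in auto)
    then have "(\<lambda>n. f x - (f x - t n x)) \<longlonglongrightarrow> f x - 0" by (intro tendsto_intros)
    then show "(\<lambda>n. t n x) \<longlonglongrightarrow> f x" by simp
  qed
  have sbi: "Bochner_Integration.simple_bochner_integrable ?M (t n)" for n
  proof (rule simple_bochner_integrable.intros[OF t])
    have "emeasure ?M {y \<in> space ?M. t n y \<noteq> 0} \<le> emeasure ?M (space ?M)"
      by (rule emeasure_space)
    also have "\<dots> = emeasure lebesgue S" using S by (simp add: emeasure_restrict_space sp)
    also have "\<dots> < \<infinity>" using fmeasurableD2[OF Slm] by (simp add: less_top)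
    finally show "emeasure ?M {y \<in> space ?M. t n y \<noteq> 0} \<noteq> \<infinity>" by simp
  qed
  have C0: "(\<lambda>n. C * (1/2) ^ n) \<longlonglongrightarrow> 0"
    by (intro tendsto_mult_right_zero LIMSEQ_realpow_zero) auto
  then have C0': "(\<lambda>n. ennreal (C * (1/2) ^ n)) \<longlonglongrightarrow> 0"
    using tendsto_ennrealI[OF C0] by simp
  have L1b: "(\<integral>\<^sup>+x. norm (f x - t n x) \<partial>?M) \<le> ennreal (C * (1/2) ^ n)" for n
  proof -
    have "(\<integral>\<^sup>+x. norm (f x - t n x) \<partial>?M) \<le> (\<integral>\<^sup>+x. k n x \<partial>?M)"
      using tk S sp by (intro nn_integral_mono ennreal_leI) auto
    then show ?thesis using kb[of n] order_trans by blast
  qed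
  have L1: "(\<lambda>n. \<integral>\<^sup>+x. norm (f x - t n x) \<partial>?M) \<longlonglongrightarrow> 0"
    by (rule tendsto_sandwich[OF _ _ tendsto_const C0'])
       (rule always_eventually, rule allI, simp, rule always_eventually, rule allI, rule L1b)
  have fS: "f integrable_on S"
  proof -
    have "f integrable_on (S \<inter> {a..b})"
      using cont_approximable_integrable[OF cont_approximable_restrict[OF f S(1)]]
      by (simp only: integrable_restrict_Int)
    then show ?thesis using S(2) by (simp add: Int_absorb2)
  qed
  let ?I = "\<lambda>n. Bochner_Integration.simple_bochner_integral ?M (t n)"
  have "norm (?I n - integral S f) \<le> C * (1/2) ^ n" for n
  proof -
    have ti: "(t n has_integral ?I n) S"
      by (rule has_integral_simple_bochner_integral[OF t Slm])
    have d: "((\<lambda>x. t n x - f x) has_integral (?I n - integral S f)) S"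
      by (intro has_integral_diff ti integrable_integral fS)
    then have "((\<lambda>x. if x \<in> S then t n x - f x else 0) has_integral (?I n - integral S f)) {a..b}"
      using S(2) by simp
    then have "norm (?I n - integral S f) \<le> integral {a..b} (k n)"
      using integral_norm_bound_integral[of "\<lambda>x. if x \<in> S then t n x - f x else 0" "{a..b}" "k n"]
        k[of n] tk[of _ n] k0[of _ n]
      by (auto simp: integral_unique norm_minus_commute)
    then show ?thesis using kC[of n] by simp
  qed
  then have "(\<lambda>n. ?I n - integral S f) \<longlonglongrightarrow> 0"
    by (intro Lim_null_comparison[OF _ C0]) auto
  then have "?I \<longlonglongrightarrow> integral S f" by (rule LIM_zero_cancel)
  then show ?thesis
    unfolding has_Bochner_def strongly_measurable_def using t AE sbi L1 by blast
qed

lemma Bochner_integrable_iff_cont_approximable: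
  "Bochner_integrable (lebesgue_on {a..b}) f \<longleftrightarrow> cont_approximable a b f"
  using Bochner_imp_cont_approximable cont_approximable_has_Bochner[of a b f "{a..b}"]
  by (auto simp: Bochner_integrable_def)

lemma Bochner_integral_eq_integral:
  assumes "cont_approximable a b f"
  shows "Bochner_integral (lebesgue_on {a..b}) f = integral {a..b} f"
proof -
  have "has_Bochner (lebesgue_on {a..b}) f (integral {a..b} f)"
    by (rule cont_approximable_has_Bochner[OF assms]) auto
  moreover have "complete_measure (lebesgue_on {a..b})"
    by (rule complete_measure_lebesgue_on) simp
  ultimately show ?thesis
    unfolding Bochner_integral_def using has_Bochner_unique by (intro the_equality) blast+
qed

lemma admissible_interval_nonempty_upward_closed:
  assumes "admissible_interval J"
  shows "J \<noteq> {}" "\<And>x y. x \<in> J \<Longrightarrow> x \<le> y \<Longrightarrow> y \<in> J"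
proof -
  have "\<alpha> + 1 \<in> {\<alpha><..}" "\<alpha> \<in> {\<alpha>..}" for \<alpha> :: real by auto
  then show "J \<noteq> {}" using assms unfolding admissible_interval_def by (metis UNIV_not_empty empty_iff)
  show "\<And>x y. x \<in> J \<Longrightarrow> x \<le> y \<Longrightarrow> y \<in> J"
    using assms by (auto simp: admissible_interval_def)
qed

text \<open>A compact subset of \<open>J\<close> lies in a compact interval contained in \<open>J\<close>.\<close>
lemma L1_loc_iff_cont_approximable:
  assumes J: "admissible_interval J"
  shows "f \<in> L1_loc J \<longleftrightarrow> (\<forall>a b. {a..b} \<subseteq> J \<longrightarrow> cont_approximable a b f)"
proof
  assume "f \<in> L1_loc J"
  then show "\<forall>a b. {a..b} \<subseteq> J \<longrightarrow> cont_approximable a b f"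
    by (auto simp: L1_loc_def Bochner_integrable_iff_cont_approximable[symmetric])
next
  assume f: "\<forall>a b. {a..b} \<subseteq> J \<longrightarrow> cont_approximable a b f"
  have "Bochner_integrable (lebesgue_on K) f" if K: "compact K" "K \<subseteq> J" for K
  proof -
    obtain a b where ab: "K \<subseteq> {a..b}" "{a..b} \<subseteq> J"
    proof (cases "K = {}")
      case True
      then show thesis using that[of 1 0] by simp
    next
      case False
      obtain a where a: "a \<in> K" "\<forall>x\<in>K. a \<le> x"
        using compact_attains_inf[OF K(1) False] by blast
      obtain b where b: "b \<in> K" "\<forall>x\<in>K. x \<le> b"
        using compact_attains_sup[OF K(1) False] by blast
      have "{a..b} \<subseteq> J"
        using admissible_interval_nonempty_upward_closed(2)[OF J, of a] a(1) K(2) by auto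
      moreover have "K \<subseteq> {a..b}" using a(2) b(2) by auto
      ultimately show thesis using that by blast
    qed
    have "K \<in> sets lebesgue" using K(1) by (simp add: compact_imp_closed)
    from cont_approximable_has_Bochner[OF _ this ab(1)] f ab(2)
    show ?thesis by (auto simp: Bochner_integrable_def)
  qed
  then show "f \<in> L1_loc J" by (simp add: L1_loc_def)
qed

section \<open>Translations and moving averages in the mean\<close>

text \<open>The constant \<open>H\<close> is the room that is left for translations: \<open>f\<close> is approximable on \<open>[a, b + H]\<close>.\<close>
lemma L1_norm_translate_le:
  assumes f: "cont_approximable a (b + H) f" and s: "0 \<le> s" "s \<le> H"
  shows "(\<lambda>t. norm (f (t + s))) integrable_on {a..b}"
    and "integral {a..b} (\<lambda>t. norm (f (t + s))) \<le> integral {a..b + H} (\<lambda>t. norm (f t))"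
proof -
  note i = cont_approximable_norm_integrable[OF f]
  have "(\<lambda>t. norm (f t)) integrable_on {a + s..b + s}"
    "integral {a + s..b + s} (\<lambda>t. norm (f t)) \<le> integral {a..b + H} (\<lambda>t. norm (f t))"
    using nonneg_integrable_subinterval[OF i, of "a + s" "b + s"] s by auto
  then show "(\<lambda>t. norm (f (t + s))) integrable_on {a..b}"
    "integral {a..b} (\<lambda>t. norm (f (t + s))) \<le> integral {a..b + H} (\<lambda>t. norm (f t))"
    using integrable_translate[of "\<lambda>t. norm (f t)" s a b]
      integral_translate[of a b "\<lambda>t. norm (f t)" s] by simp_all
qed

lemma cont_approximable_translate_right:
  assumes "cont_approximable a (b + H) f" "0 \<le> s" "s \<le> H"
  shows "cont_approximable a b (\<lambda>t. f (t + s))"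
  using assms by (intro cont_approximable_translate cont_approximable_subinterval[OF assms(1)]) auto

text \<open>For continuous functions this is uniform continuity; the general case follows because translation does
not increase the \<open>L\<^sup>1\<close> distance to the approximant.\<close>
lemma L1_continuity_of_translation:
  assumes f: "cont_approximable a (b + H) f" and "a \<le> b" "0 < e"
  obtains d where "0 < d"
    "\<And>s s'. s \<in> {0..H} \<Longrightarrow> s' \<in> {0..H} \<Longrightarrow> \<bar>s - s'\<bar> < d \<Longrightarrow>
       integral {a..b} (\<lambda>t. norm (f (t + s) - f (t + s'))) \<le> e"
proof -
  have e: "0 < e/3" using assms by simp
  from cont_approximable_obtain[OF f this] obtain g where g: "continuous_on {a..b + H} g"
    "cont_approximable a (b + H) (\<lambda>t. f t - g t)"
    "integral {a..b + H} (\<lambda>t. norm (f t - g t)) < e/3" by blast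
  define e1 where "e1 = e / 3 / (b - a + 1)"
  have e1: "0 < e1" using assms by (simp add: e1_def)
  have "uniformly_continuous_on {a..b + H} g"
    using g(1) by (intro compact_uniformly_continuous) auto
  then obtain d where d: "0 < d"
    "\<And>x y. x \<in> {a..b + H} \<Longrightarrow> y \<in> {a..b + H} \<Longrightarrow> dist y x < d \<Longrightarrow> dist (g y) (g x) < e1"
    unfolding uniformly_continuous_on_def using e1 by meson
  show thesis
  proof (rule that[OF d(1)])
    fix s s' assume s: "s \<in> {0..H}" "s' \<in> {0..H}" "\<bar>s - s'\<bar> < d"
    let ?k = "\<lambda>s t. norm (f (t + s) - g (t + s))"
    have k: "?k s integrable_on {a..b}" "?k s' integrable_on {a..b}"
      "integral {a..b} (?k s) < e/3" "integral {a..b} (?k s') < e/3"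
      using L1_norm_translate_le[OF g(2), of s] L1_norm_translate_le[OF g(2), of s'] s g(3) by auto
    have c: "((\<lambda>_. e1) has_integral (b - a) * e1) {a..b}"
      using has_integral_const_real[of e1 a b] assms(2) by simp
    have "integral {a..b} (\<lambda>t. norm (f (t + s) - f (t + s')))
        \<le> integral {a..b} (\<lambda>t. ?k s t + ?k s' t + e1)"
    proof (rule integral_le)
      show "(\<lambda>t. norm (f (t + s) - f (t + s'))) integrable_on {a..b}"
        using s by (intro cont_approximable_norm_integrable cont_approximable_diff
            cont_approximable_translate_right[OF f]) auto
      show "(\<lambda>t. ?k s t + ?k s' t + e1) integrable_on {a..b}"
        using k c by (intro integrable_add) blast+
      fix t assume t: "t \<in> {a..b}"
      have "dist (g (t + s)) (g (t + s')) < e1"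
        using t s by (intro d(2)) (auto simp: dist_real_def)
      moreover have "f (t + s) - f (t + s')
          = (f (t + s) - g (t + s)) - (f (t + s') - g (t + s')) + (g (t + s) - g (t + s'))" by simp
      then have "norm (f (t + s) - f (t + s')) \<le> ?k s t + ?k s' t + norm (g (t + s) - g (t + s'))"
        by (metis norm_triangle_le norm_triangle_ineq4 add_right_mono)
      ultimately show "norm (f (t + s) - f (t + s')) \<le> ?k s t + ?k s' t + e1"
        by (simp add: dist_norm)
    qed
    also have "\<dots> = integral {a..b} (?k s) + integral {a..b} (?k s') + (b - a) * e1"
      using k by (intro integral_unique has_integral_add c) auto
    also have "(b - a) * e1 \<le> e/3"
      using assms by (simp add: e1_def field_simps)
    finally show "integral {a..b} (\<lambda>t. norm (f (t + s) - f (t + s'))) \<le> e" using k by simp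
  qed
qed

lemma integral_translated_window:
  fixes f :: "real \<Rightarrow> 'a::banach"
  assumes "f integrable_on {a..b + h}" "0 \<le> h" "t \<in> {a..b}"
  shows "integral {t..t + h} f = integral {a..t + h} f - integral {a..t} f"
proof -
  have "f integrable_on {a..t + h}"
    using assms by (intro integrable_on_subinterval[OF assms(1)]) auto
  from Henstock_Kurzweil_Integration.integral_combine[OF _ _ this, of t] assms show ?thesis
    by (auto simp: algebra_simps)
qed

lemma continuous_on_integral_window:
  fixes f :: "real \<Rightarrow> 'a::banach"
  assumes f: "f integrable_on {a..b + h}" and h: "0 \<le> h"
  shows "continuous_on {a..b} (\<lambda>t. integral {t..t + h} f)"
proof -
  note F = indefinite_integral_continuous_1[OF f]
  have "continuous_on {a..b} (\<lambda>t. integral {a..t + h} f - integral {a..t} f)"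
  proof (intro continuous_on_diff)
    show "continuous_on {a..b} (\<lambda>t. integral {a..t + h} f)"
      by (rule continuous_on_compose2[OF F]) (use h in \<open>auto intro: continuous_intros\<close>)
    show "continuous_on {a..b} (\<lambda>t. integral {a..t} f)"
      using F by (rule continuous_on_subset) (use h in auto)
  qed
  then show ?thesis
    by (rule continuous_on_eq) (simp add: integral_translated_window[OF f h])
qed

text \<open>Fubini would give this at once. With \<open>F x = integral {a..x} k\<close>, however, the left-hand side is the integral of
\<open>F (t + h) - F t\<close>, which telescopes to \<open>integral {b..b + h} F - integral {a..a + h} F\<close>, and
\<open>0 \<le> F \<le> F (b + h)\<close>.\<close>
lemma integral_integral_window_le:
  fixes k :: "real \<Rightarrow> real"
  assumes k: "k integrable_on {a..b + h}" and k0: "\<And>t. t \<in> {a..b + h} \<Longrightarrow> 0 \<le> k t"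
    and h: "0 \<le> h" and ab: "a \<le> b"
  shows "integral {a..b} (\<lambda>t. integral {t..t + h} k) \<le> h * integral {a..b + h} k"
proof -
  define F where "F = (\<lambda>x. integral {a..x} k)"
  have Fc: "continuous_on {a..b + h} F"
    unfolding F_def by (rule indefinite_integral_continuous_1[OF k])
  have Fi: "F integrable_on {c..d}" if "{c..d} \<subseteq> {a..b + h}" for c d
    using continuous_on_subset[OF Fc that] by (rule integrable_continuous_real)
  have F0: "0 \<le> F x" "F x \<le> F (b + h)" if "x \<in> {a..b + h}" for x
    unfolding F_def
    using nonneg_integrable_subinterval[OF k k0, of a x] that k0
    by (auto intro!: integral_nonneg)
  have "integral {a..b} (\<lambda>t. integral {t..t + h} k) = integral {a..b} (\<lambda>t. F (t + h) - F t)"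
    unfolding F_def
    by (rule Henstock_Kurzweil_Integration.integral_cong) (rule integral_translated_window[OF k h])
  also have "\<dots> = integral {a..b} (\<lambda>t. F (t + h)) - integral {a..b} F"
    using h by (intro Henstock_Kurzweil_Integration.integral_diff Fi) (auto simp: integrable_translate intro!: Fi)
  also have "integral {a..b} (\<lambda>t. F (t + h)) = integral {a + h..b + h} F"
    by (rule integral_translate)
  also have "integral {a + h..b + h} F - integral {a..b} F = integral {b..b + h} F - integral {a..a + h} F"
    using Henstock_Kurzweil_Integration.integral_combine[OF _ _ Fi, of a "a + h" "b + h"]
      Henstock_Kurzweil_Integration.integral_combine[OF _ _ Fi, of a b "b + h"] h ab by simp
  also have "\<dots> \<le> integral {b..b + h} (\<lambda>_. F (b + h)) - 0"
    using h ab F0 by (intro diff_mono integral_le Henstock_Kurzweil_Integration.integral_nonneg Fi) auto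
  also have "\<dots> = h * integral {a..b + h} k" using h by (simp add: F_def)
  finally show ?thesis .
qed

lemma riemann_sum_error:
  fixes g :: "real \<Rightarrow> 'a::banach"
  assumes "0 \<le> d" and g: "g integrable_on {t..t + real n * d}"
    and osc: "\<And>u v. u \<in> {t..t + real n * d} \<Longrightarrow> v \<in> {t..t + real n * d} \<Longrightarrow> \<bar>u - v\<bar> \<le> d \<Longrightarrow>
        norm (g u - g v) \<le> e"
  shows "norm (integral {t..t + real n * d} g - d *\<^sub>R (\<Sum>i<n. g (t + real i * d))) \<le> real n * d * e"
  using g osc
proof (induction n)
  case 0
  then show ?case by simp
next
  case (Suc n)
  let ?u = "t + real n * d" and ?v = "t + real (Suc n) * d"
  have uv: "?v = ?u + d" "t \<le> ?u" "?u \<le> ?v" using \<open>0 \<le> d\<close> by (auto simp: algebra_simps)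
  have i1: "g integrable_on {t..?u}" and i2: "g integrable_on {?u..?v}"
    using uv(2,3) by (intro integrable_on_subinterval[OF Suc.prems(1)], force)+
  have IH: "norm (integral {t..?u} g - d *\<^sub>R (\<Sum>i<n. g (t + real i * d))) \<le> real n * d * e"
    by (rule Suc.IH[OF i1]) (rule Suc.prems(2), use uv in auto)
  have c: "((\<lambda>_. g ?u) has_integral d *\<^sub>R g ?u) {?u..?v}"
    using has_integral_const_real[of "g ?u" ?u ?v] uv \<open>0 \<le> d\<close> by simp
  have "norm (integral {?u..?v} (\<lambda>x. g x - g ?u)) \<le> integral {?u..?v} (\<lambda>_. e)"
  proof (rule integral_norm_bound_integral)
    show "(\<lambda>x. g x - g ?u) integrable_on {?u..?v}" using i2 c by (intro integrable_diff) blast+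
    show "norm (g x - g ?u) \<le> e" if "x \<in> {?u..?v}" for x
    proof (rule Suc.prems(2))
      show "x \<in> {t..?v}" "?u \<in> {t..?v}" using that uv(2,3) by simp_all
      show "\<bar>x - ?u\<bar> \<le> d" using that uv(1) by simp
    qed
  qed auto
  also have "integral {?u..?v} (\<lambda>x. g x - g ?u) = integral {?u..?v} g - d *\<^sub>R g ?u"
    using i2 by (intro integral_unique has_integral_diff c) auto
  also have "integral {?u..?v} (\<lambda>_. e) = d * e" using uv \<open>0 \<le> d\<close> by simp
  finally have step: "norm (integral {?u..?v} g - d *\<^sub>R g ?u) \<le> d * e" .
  have "integral {t..?v} g = integral {t..?u} g + integral {?u..?v} g"
    using Henstock_Kurzweil_Integration.integral_combine[OF uv(2,3) Suc.prems(1)] by simp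
  then have "integral {t..?v} g - d *\<^sub>R (\<Sum>i<Suc n. g (t + real i * d))
     = (integral {t..?u} g - d *\<^sub>R (\<Sum>i<n. g (t + real i * d))) + (integral {?u..?v} g - d *\<^sub>R g ?u)"
    by (simp add: algebra_simps)
  then have "norm (integral {t..?v} g - d *\<^sub>R (\<Sum>i<Suc n. g (t + real i * d))) \<le> real n * d * e + d * e"
    using IH step norm_triangle_mono by metis
  then show ?case by (simp add: algebra_simps)
qed

text \<open>The moving average is replaced by a Riemann sum with \<open>n\<close> nodes. For the continuous approximant \<open>g\<close> of \<open>f\<close>
the error is uniformly small; the moving average and the Riemann sum of \<open>f - g\<close> are both controlled by the
integral of \<open>norm (f - g)\<close> over \<open>[a, b + h]\<close>.\<close>
lemma L1_mean_riemann_approximation: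
  fixes f :: "real \<Rightarrow> 'a::banach"
  assumes f: "cont_approximable a (b + h) f" and h: "0 < h" and ab: "a \<le> b" and "0 < e"
  obtains n :: nat where "0 < n"
    "integral {a..b} (\<lambda>t. norm ((1/h) *\<^sub>R integral {t..t + h} f
        - (1 / real n) *\<^sub>R (\<Sum>i<n. f (t + real i * (h / real n))))) \<le> e"
proof -
  have e: "0 < e/3" using \<open>0 < e\<close> by simp
  from cont_approximable_obtain[OF f this] obtain g where g: "continuous_on {a..b + h} g"
    "cont_approximable a (b + h) (\<lambda>t. f t - g t)"
    "integral {a..b + h} (\<lambda>t. norm (f t - g t)) < e/3" by blast
  define k where "k = (\<lambda>t. norm (f t - g t))"
  define E where "E = integral {a..b + h} k"
  have E: "E < e/3" using g(3) by (simp add: E_def k_def)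
  have k: "k integrable_on {a..b + h}" unfolding k_def by (rule cont_approximable_norm_integrable[OF g(2)])
  have k0: "0 \<le> k t" for t by (simp add: k_def)
  define e1 where "e1 = e / 3 / (b - a + 1)"
  have e1: "0 < e1" using assms by (simp add: e1_def)
  have "uniformly_continuous_on {a..b + h} g"
    using g(1) by (intro compact_uniformly_continuous) auto
  then obtain d where d: "0 < d"
    "\<And>x y. x \<in> {a..b + h} \<Longrightarrow> y \<in> {a..b + h} \<Longrightarrow> dist y x < d \<Longrightarrow> dist (g y) (g x) < e1"
    unfolding uniformly_continuous_on_def using e1 by meson
  obtain n :: nat where n: "h / d < real n" using reals_Archimedean2 by blast
  have n0: "0 < n" using n h d(1) by (cases n) (auto simp: not_less divide_pos_pos dest: order.asym)
  define \<delta> where "\<delta> = h / real n"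
  have \<delta>: "0 < \<delta>" "\<delta> < d" "real n * \<delta> = h"
    using n n0 h d(1) by (auto simp: \<delta>_def field_simps)
  have i\<delta>: "0 \<le> real i * \<delta>" "real i * \<delta> \<le> h" if "i < n" for i
  proof -
    show "0 \<le> real i * \<delta>" using \<delta>(1) by simp
    have "real i * \<delta> \<le> real n * \<delta>" using that \<delta>(1) by (intro mult_right_mono) auto
    then show "real i * \<delta> \<le> h" using \<delta>(3) by simp
  qed
  let ?M = "\<lambda>f t. (1/h) *\<^sub>R integral {t..t + h} f" 
  let ?R = "\<lambda>f t. (1 / real n) *\<^sub>R (\<Sum>i<n. f (t + real i * \<delta>))"
  let ?B = "\<lambda>t. (1/h) * integral {t..t + h} k + e1 + (1 / real n) * (\<Sum>i<n. k (t + real i * \<delta>))"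
  have Mc: "cont_approximable a b (\<lambda>t. (1/h) *\<^sub>R integral {t..t + h} f)"
    using h by (intro cont_approximable_continuous continuous_intros continuous_on_integral_window
        cont_approximable_integrable[OF f]) auto
  have kw: "(\<lambda>t. integral {t..t + h} k) integrable_on {a..b}"
    using h by (intro integrable_continuous_real continuous_on_integral_window k) auto
  have ki: "(\<lambda>t. k (t + real i * \<delta>)) integrable_on {a..b}"
      "integral {a..b} (\<lambda>t. k (t + real i * \<delta>)) \<le> E" if "i < n" for i
    using L1_norm_translate_le[OF g(2) i\<delta>[OF that]] unfolding k_def E_def by auto
  have kR: "(\<lambda>t. \<Sum>i<n. k (t + real i * \<delta>)) integrable_on {a..b}"
    using ki(1) by (intro integrable_sum) auto
  have c: "((\<lambda>_. e1) has_integral (b - a) * e1) {a..b}"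
    using has_integral_const_real[of e1 a b] ab by simp
  have B: "(?B has_integral (1/h) * integral {a..b} (\<lambda>t. integral {t..t + h} k) + (b - a) * e1
       + (1 / real n) * integral {a..b} (\<lambda>t. \<Sum>i<n. k (t + real i * \<delta>))) {a..b}"
    by (intro has_integral_add has_integral_mult_right c integrable_integral kw kR)
  have pt: "norm ((1/h) *\<^sub>R integral {t..t + h} f - (1 / real n) *\<^sub>R (\<Sum>i<n. f (t + real i * \<delta>))) \<le> ?B t"
    if t: "t \<in> {a..b}" for t
  proof -
    have sub: "{t..t + h} \<subseteq> {a..b + h}" using t by auto
    have gi: "g integrable_on {t..t + h}"
      using continuous_on_subset[OF g(1) sub] by (rule integrable_continuous_real)
    have fg: "cont_approximable t (t + h) (\<lambda>t. f t - g t)"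
      by (rule cont_approximable_subinterval[OF g(2) sub])
    have fi: "f integrable_on {t..t + h}"
      by (rule cont_approximable_integrable[OF cont_approximable_subinterval[OF f sub]])
    have 1: "norm ((1/h) *\<^sub>R (integral {t..t + h} f - integral {t..t + h} g)) \<le> (1/h) * integral {t..t + h} k"
      using cont_approximable_norm_integral_le[OF fg] fi gi h
      by (simp add: Henstock_Kurzweil_Integration.integral_diff k_def divide_right_mono)
    have "norm (integral {t..t + real n * \<delta>} g - \<delta> *\<^sub>R (\<Sum>i<n. g (t + real i * \<delta>))) \<le> real n * \<delta> * e1"
    proof (rule riemann_sum_error)
      fix u v assume "u \<in> {t..t + real n * \<delta>}" "v \<in> {t..t + real n * \<delta>}" "\<bar>u - v\<bar> \<le> \<delta>"
      then have "dist (g u) (g v) < e1" using sub \<delta> by (intro d(2)) (auto simp: dist_real_def)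
      then show "norm (g u - g v) \<le> e1" by (simp add: dist_norm)
    qed (use \<delta> gi in auto)
    then have err: "norm (integral {t..t + h} g - \<delta> *\<^sub>R (\<Sum>i<n. g (t + real i * \<delta>))) \<le> h * e1"
      by (simp only: \<delta>(3))
    have "(1/h) *\<^sub>R integral {t..t + h} g - (1 / real n) *\<^sub>R (\<Sum>i<n. g (t + real i * \<delta>))
        = (1/h) *\<^sub>R (integral {t..t + h} g - \<delta> *\<^sub>R (\<Sum>i<n. g (t + real i * \<delta>)))"
      using h n0 by (simp add: \<delta>_def scaleR_diff_right)
    also have "norm \<dots> = (1/h) * norm (integral {t..t + h} g - \<delta> *\<^sub>R (\<Sum>i<n. g (t + real i * \<delta>)))"
      using h by simp
    also have "\<dots> \<le> (1/h) * (h * e1)" using h by (intro mult_left_mono err) simp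
    also have "\<dots> = e1" using h by simp
    finally have 2: "norm ((1/h) *\<^sub>R integral {t..t + h} g - (1 / real n) *\<^sub>R (\<Sum>i<n. g (t + real i * \<delta>))) \<le> e1" .
    have 3: "norm ((1 / real n) *\<^sub>R (\<Sum>i<n. f (t + real i * \<delta>) - g (t + real i * \<delta>)))
        \<le> (1 / real n) * (\<Sum>i<n. k (t + real i * \<delta>))"
      using n0 by (simp add: k_def norm_sum divide_right_mono)
    have split: "(1/h) *\<^sub>R integral {t..t + h} f - (1 / real n) *\<^sub>R (\<Sum>i<n. f (t + real i * \<delta>))
      = (1/h) *\<^sub>R (integral {t..t + h} f - integral {t..t + h} g)
        + ((1/h) *\<^sub>R integral {t..t + h} g - (1 / real n) *\<^sub>R (\<Sum>i<n. g (t + real i * \<delta>)))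
        - (1 / real n) *\<^sub>R (\<Sum>i<n. f (t + real i * \<delta>) - g (t + real i * \<delta>))"
      by (simp add: sum_subtractf scaleR_diff_right)
    show ?thesis unfolding split
      by (rule order_trans[OF norm_triangle_ineq4 add_mono[OF order_trans[OF norm_triangle_ineq add_mono[OF 1 2]] 3]])
  qed
  have "integral {a..b} (\<lambda>t. norm ((1/h) *\<^sub>R integral {t..t + h} f
        - (1 / real n) *\<^sub>R (\<Sum>i<n. f (t + real i * \<delta>)))) \<le> integral {a..b} ?B"
  proof (rule integral_le)
    show "(\<lambda>t. norm ((1/h) *\<^sub>R integral {t..t + h} f
        - (1 / real n) *\<^sub>R (\<Sum>i<n. f (t + real i * \<delta>)))) integrable_on {a..b}"
      using i\<delta> by (intro cont_approximable_norm_integrable cont_approximable_diff Mc cont_approximable_scaleR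
          cont_approximable_sum cont_approximable_translate_right[OF f]) auto
  qed (use pt B in auto)
  also have "\<dots> = (1/h) * integral {a..b} (\<lambda>t. integral {t..t + h} k) + (b - a) * e1
       + (1 / real n) * integral {a..b} (\<lambda>t. \<Sum>i<n. k (t + real i * \<delta>))"
    by (rule integral_unique[OF B])
  also have "\<dots> \<le> e/3 + e/3 + e/3"
  proof (intro add_mono)
    have "integral {a..b} (\<lambda>t. integral {t..t + h} k) \<le> h * E"
      unfolding E_def using h ab by (intro integral_integral_window_le k k0) auto
    then have "(1/h) * integral {a..b} (\<lambda>t. integral {t..t + h} k) \<le> E" using h by (simp add: field_simps)
    then show "(1/h) * integral {a..b} (\<lambda>t. integral {t..t + h} k) \<le> e/3" using E by linarith
    show "(b - a) * e1 \<le> e/3" using assms by (simp add: e1_def field_simps)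
    have "integral {a..b} (\<lambda>t. \<Sum>i<n. k (t + real i * \<delta>)) = (\<Sum>i<n. integral {a..b} (\<lambda>t. k (t + real i * \<delta>)))"
      using ki(1) by (intro Henstock_Kurzweil_Integration.integral_sum) auto
    also have "\<dots> \<le> (\<Sum>i<n. e/3)"
    proof (rule sum_mono)
      fix i assume "i \<in> {..<n}"
      then show "integral {a..b} (\<lambda>t. k (t + real i * \<delta>)) \<le> e/3" using ki(2)[of i] E by simp
    qed
    finally show "(1 / real n) * integral {a..b} (\<lambda>t. \<Sum>i<n. k (t + real i * \<delta>)) \<le> e/3"
      using n0 by (simp add: field_simps)
  qed
  finally show thesis using that[OF n0] by (simp add: \<delta>_def)
qed

section \<open>Seminorms of averages\<close>

text \<open>The norm of the integral and the integral of the norm are treated together. They share sublinearity,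
domination by the \<open>L\<^sup>1\<close> norm, translation covariance, and a control of the right part of an interval by the
whole interval and the left part. The last property is what makes averages insensitive to the starting
point.\<close>
locale interval_seminorm =
  fixes q :: "real \<Rightarrow> real \<Rightarrow> (real \<Rightarrow> 'a::banach) \<Rightarrow> real"
  assumes add_le: "\<lbrakk>cont_approximable a b f; cont_approximable a b g\<rbrakk>
      \<Longrightarrow> q a b (\<lambda>t. f t + g t) \<le> q a b f + q a b g"
    and scaleR: "cont_approximable a b f \<Longrightarrow> q a b (\<lambda>t. c *\<^sub>R f t) = \<bar>c\<bar> * q a b f"
    and le_L1_norm: "cont_approximable a b f \<Longrightarrow> q a b f \<le> integral {a..b} (\<lambda>t. norm (f t))"
    and translate: "q a b (\<lambda>t. f (t + u)) = q (a + u) (b + u) f"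
    and split_le: "\<lbrakk>a \<le> b; b \<le> c; cont_approximable a c f\<rbrakk> \<Longrightarrow> q b c f \<le> q a c f + q a b f"
begin

lemma zero: "q a b (\<lambda>_. 0) = 0"
  using scaleR[of a b "\<lambda>_. 0" 0] by (simp add: cont_approximable_continuous)

lemma diff_le:
  assumes "cont_approximable a b f" "cont_approximable a b g"
  shows "q a b (\<lambda>t. f t - g t) \<le> q a b f + q a b g"
  using add_le[OF assms(1) cont_approximable_scaleR[OF assms(2), of "-1"]]
    scaleR[OF assms(2), of "-1"] by simp

text \<open>Every interval seminorm is Lipschitz with respect to the \<open>L\<^sup>1\<close> distance. This is how approximations in the
mean are transferred to \<open>q\<close>.\<close>
lemma le_plus_L1_distance:
  assumes "cont_approximable a b f" "cont_approximable a b g"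
  shows "q a b f \<le> q a b g + integral {a..b} (\<lambda>t. norm (f t - g t))"
  using add_le[OF assms(2) cont_approximable_diff[OF assms]]
    le_L1_norm[OF cont_approximable_diff[OF assms]] by simp

lemma sum_le:
  assumes "finite A" "\<And>i. i \<in> A \<Longrightarrow> cont_approximable a b (f i)"
  shows "q a b (\<lambda>t. \<Sum>i\<in>A. f i t) \<le> (\<Sum>i\<in>A. q a b (f i))"
  using assms
proof (induction A rule: finite_induct)
  case (insert i A)
  have "q a b (\<lambda>t. \<Sum>i\<in>insert i A. f i t) = q a b (\<lambda>t. f i t + (\<Sum>i\<in>A. f i t))"
    using insert by simp
  also have "\<dots> \<le> q a b (f i) + q a b (\<lambda>t. \<Sum>i\<in>A. f i t)"
    using insert by (intro add_le cont_approximable_sum) auto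
  finally show ?case using insert by simp
qed (simp add: zero)

definition null_mean :: "real set \<Rightarrow> (real \<Rightarrow> 'a) \<Rightarrow> bool" where
  "null_mean I f \<longleftrightarrow> (\<forall>e>0. \<exists>N>0. \<forall>T\<ge>N. \<forall>x\<in>I. q x (x + T) f \<le> e * T)"

end

lemma L1_loc_cont_approximable:
  assumes "admissible_interval J" "f \<in> L1_loc J" "x \<in> J"
  shows "cont_approximable x y f"
proof -
  have "{x..y} \<subseteq> J" using admissible_interval_nonempty_upward_closed(2)[OF assms(1,3)] by auto
  then show ?thesis using assms(2) L1_loc_iff_cont_approximable[OF assms(1)] by blast
qed

lemma L1_loc_cont_approximable_translate:
  assumes "admissible_interval J" "f \<in> L1_loc J" "x \<in> J" "0 \<le> s"
  shows "cont_approximable x y (\<lambda>t. f (t + s))"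
  using assms admissible_interval_nonempty_upward_closed(2)[OF assms(1,3), of "x + s"]
  by (intro cont_approximable_translate L1_loc_cont_approximable) auto

lemma mean_op_eq_integral_window:
  assumes "admissible_interval J" "\<phi> \<in> L1_loc J" "t \<in> J"
  shows "mean_op h \<phi> t = (1/h) *\<^sub>R integral {t..t + h} \<phi>"
proof -
  have c: "(\<lambda>s. \<phi> (t + s)) = (\<lambda>s. \<phi> (s + t))" by (simp add: add.commute)
  have "cont_approximable 0 h (\<lambda>s. \<phi> (t + s))"
    unfolding c using assms by (intro cont_approximable_translate L1_loc_cont_approximable) auto
  then have "Bochner_integral (lebesgue_on {0..h}) (\<lambda>s. \<phi> (t + s)) = integral {0..h} (\<lambda>s. \<phi> (s + t))"
    using Bochner_integral_eq_integral c by metis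
  then show ?thesis by (simp add: mean_op_def integral_translate add.commute)
qed

lemma cont_approximable_mean_op:
  assumes J: "admissible_interval J" "\<phi> \<in> L1_loc J" and x: "x \<in> J" and h: "0 < h"
  shows "cont_approximable x y (mean_op h \<phi>)"
proof (rule cont_approximable_cong)
  show "(1/h) *\<^sub>R integral {t..t + h} \<phi> = mean_op h \<phi> t" if "t \<in> {x..y}" for t
    using that mean_op_eq_integral_window[OF J] admissible_interval_nonempty_upward_closed(2)[OF J(1) x] by simp
  show "cont_approximable x y (\<lambda>t. (1/h) *\<^sub>R integral {t..t + h} \<phi>)"
    by (intro cont_approximable_continuous continuous_on_scaleR continuous_on_const
        continuous_on_integral_window cont_approximable_integrable L1_loc_cont_approximable[OF J x])
       (use h in simp)
qed

lemma diff_mean_op_in_L1_loc: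
  assumes J: "admissible_interval J" "\<phi> \<in> L1_loc J" and h: "0 < h"
  shows "(\<lambda>t. \<phi> t - mean_op h \<phi> t) \<in> L1_loc J"
  unfolding L1_loc_iff_cont_approximable[OF J(1)]
proof (intro allI impI)
  fix a b assume ab: "{a..b} \<subseteq> J"
  show "cont_approximable a b (\<lambda>t. \<phi> t - mean_op h \<phi> t)"
  proof (cases "a \<le> b")
    case True
    then have "a \<in> J" using ab by auto
    then show ?thesis
      using J h by (intro cont_approximable_diff cont_approximable_mean_op L1_loc_cont_approximable) auto
  qed (simp add: cont_approximable_continuous)
qed

context interval_seminorm
begin

text \<open>In the mean, \<open>\<phi> - mean_op h \<phi>\<close> is close to \<open>-(1/n)\<close> times the sum of the \<open>n\<close> differences \<open>diff_op (i * h / n) \<phi>\<close>,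
whose seminorm is at most the average of the individual bounds.\<close>
lemma diff_mean_op_le:
  assumes J: "admissible_interval J" "\<phi> \<in> L1_loc J" and x: "x \<in> J" and h: "0 < h" and T: "0 \<le> T"
    and c: "\<And>s. s \<in> {0..h} \<Longrightarrow> q x (x + T) (diff_op s \<phi>) \<le> c"
  shows "q x (x + T) (\<lambda>t. \<phi> t - mean_op h \<phi> t) \<le> c"
proof (rule field_le_epsilon)
  fix e :: real assume e: "0 < e"
  have f: "cont_approximable x (x + T + h) \<phi>" by (rule L1_loc_cont_approximable[OF J x])
  obtain n :: nat where n: "0 < n" and
    R: "integral {x..x + T} (\<lambda>t. norm ((1/h) *\<^sub>R integral {t..t + h} \<phi>
        - (1 / real n) *\<^sub>R (\<Sum>i<n. \<phi> (t + real i * (h / real n))))) \<le> e"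
    using L1_mean_riemann_approximation[OF f h _ e] T by auto
  define r where "r i = real i * (h / real n)" for i
  have r: "r i \<in> {0..h}" if "i < n" for i
  proof -
    have "real i * h \<le> real n * h" using that h by (intro mult_right_mono) auto
    then show ?thesis using h n by (simp add: r_def field_simps)
  qed
  note \<phi>i = L1_loc_cont_approximable[OF J x, of "x + T"]
  have \<Delta>i: "cont_approximable x (x + T) (diff_op (r i) \<phi>)" if "i < n" for i
    unfolding diff_op_def using r[OF that]
    by (intro cont_approximable_diff \<phi>i L1_loc_cont_approximable_translate[OF J x]) auto
  let ?D = "\<lambda>t. (- 1 / real n) *\<^sub>R (\<Sum>i<n. diff_op (r i) \<phi> t)"
  have D: "?D t = \<phi> t - (1 / real n) *\<^sub>R (\<Sum>i<n. \<phi> (t + r i))" for t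
    using n by (simp add: diff_op_def sum_subtractf scaleR_diff_right sum_constant_scaleR)
  have Di: "cont_approximable x (x + T) (\<lambda>t. \<Sum>i<n. diff_op (r i) \<phi> t)"
    using \<Delta>i by (intro cont_approximable_sum) auto
  have Mi: "cont_approximable x (x + T) (\<lambda>t. \<phi> t - mean_op h \<phi> t)"
    by (intro cont_approximable_diff \<phi>i cont_approximable_mean_op[OF J x h])
  have "q x (x + T) ?D = 1 / real n * q x (x + T) (\<lambda>t. \<Sum>i<n. diff_op (r i) \<phi> t)"
    using scaleR[OF Di, of "- 1 / real n"] by simp
  also have "\<dots> \<le> 1 / real n * (\<Sum>i<n. q x (x + T) (diff_op (r i) \<phi>))"
    using \<Delta>i by (intro mult_left_mono sum_le) auto
  also have "\<dots> \<le> 1 / real n * (\<Sum>i<n. c)"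
    using c r by (intro mult_left_mono sum_mono) auto
  also have "\<dots> = c" using n by simp
  finally have 1: "q x (x + T) ?D \<le> c" .
  have "integral {x..x + T} (\<lambda>t. norm ((\<phi> t - mean_op h \<phi> t) - ?D t))
     = integral {x..x + T} (\<lambda>t. norm ((1/h) *\<^sub>R integral {t..t + h} \<phi>
        - (1 / real n) *\<^sub>R (\<Sum>i<n. \<phi> (t + r i))))"
  proof (rule Henstock_Kurzweil_Integration.integral_cong)
    fix t assume "t \<in> {x..x + T}"
    then have "t \<in> J" using admissible_interval_nonempty_upward_closed(2)[OF J(1) x] by auto
    then show "norm ((\<phi> t - mean_op h \<phi> t) - ?D t) = norm ((1/h) *\<^sub>R integral {t..t + h} \<phi>
        - (1 / real n) *\<^sub>R (\<Sum>i<n. \<phi> (t + r i)))"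
      unfolding D mean_op_eq_integral_window[OF J \<open>t \<in> J\<close>] by (simp add: norm_minus_commute)
  qed
  then have 2: "integral {x..x + T} (\<lambda>t. norm ((\<phi> t - mean_op h \<phi> t) - ?D t)) \<le> e"
    using R by (simp add: r_def)
  show "q x (x + T) (\<lambda>t. \<phi> t - mean_op h \<phi> t) \<le> c + e"
    using le_plus_L1_distance[OF Mi cont_approximable_scaleR[OF Di, of "- 1 / real n"]] 1 2 by linarith
qed

text \<open>The difference of \<open>diff_op u \<phi>\<close> and \<open>diff_op v \<phi>\<close> is the difference of the translates of \<open>\<phi>\<close> by \<open>u\<close> and \<open>v\<close>,
so continuity of translation in \<open>L\<^sup>1\<close> applies.\<close>
lemma continuous_on_seminorm_diff_op:
  assumes J: "admissible_interval J" "\<phi> \<in> L1_loc J" and x: "x \<in> J" and T: "0 \<le> T"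
  shows "continuous_on {0..} (\<lambda>s. q x (x + T) (diff_op s \<phi>))"
  unfolding continuous_on_iff
proof (intro ballI allI impI)
  fix s e :: real assume s: "s \<in> {0..}" and "0 < e"
  then have e: "0 < e/2" by simp
  have f: "cont_approximable x (x + T + (s + 1)) \<phi>" by (rule L1_loc_cont_approximable[OF J x])
  obtain d where d: "0 < d"
    "\<And>u v. u \<in> {0..s + 1} \<Longrightarrow> v \<in> {0..s + 1} \<Longrightarrow> \<bar>u - v\<bar> < d \<Longrightarrow>
       integral {x..x + T} (\<lambda>t. norm (\<phi> (t + u) - \<phi> (t + v))) \<le> e/2"
    by (rule L1_continuity_of_translation[OF f _ e]) (use T in auto)
  have \<Delta>i: "cont_approximable x (x + T) (diff_op u \<phi>)" if "0 \<le> u" for u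
    unfolding diff_op_def using that
    by (intro cont_approximable_diff L1_loc_cont_approximable[OF J x]
        L1_loc_cont_approximable_translate[OF J x])
  have le: "q x (x + T) (diff_op u \<phi>) \<le> q x (x + T) (diff_op v \<phi>) + e/2"
    if "u \<in> {0..s + 1}" "v \<in> {0..s + 1}" "\<bar>u - v\<bar> < d" for u v
  proof -
    have "integral {x..x + T} (\<lambda>t. norm (diff_op u \<phi> t - diff_op v \<phi> t)) \<le> e/2"
      using d(2)[OF that] by (simp add: diff_op_def)
    then show ?thesis using le_plus_L1_distance[OF \<Delta>i[of u] \<Delta>i[of v]] that by simp
  qed
  show "\<exists>d>0. \<forall>s'\<in>{0..}. dist s' s < d \<longrightarrow>
      dist (q x (x + T) (diff_op s' \<phi>)) (q x (x + T) (diff_op s \<phi>)) < e"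
  proof (intro exI[of _ "min d 1"] conjI ballI impI)
    show "0 < min d 1" using d by simp
    fix s' assume "s' \<in> {0..}" "dist s' s < min d 1"
    then have s': "s' \<in> {0..s + 1}" "s \<in> {0..s + 1}" "\<bar>s' - s\<bar> < d" "\<bar>s - s'\<bar> < d"
      using s by (auto simp: dist_real_def)
    show "dist (q x (x + T) (diff_op s' \<phi>)) (q x (x + T) (diff_op s \<phi>)) < e"
      using le[OF s'(1,2,3)] le[OF s'(2,1,4)] \<open>0 < e\<close> by (simp add: dist_real_def abs_less_iff)
  qed
qed

end

section \<open>Uniformity in the step of the difference\<close>

text \<open>The case \<open>I = J\<close> serves the ergodic classes, the case of a singleton the Cesaro classes.\<close>
locale interval_seminorm_family = interval_seminorm q
  for q :: "real \<Rightarrow> real \<Rightarrow> (real \<Rightarrow> 'a::banach) \<Rightarrow> real" +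
  fixes J I :: "real set"
  assumes J: "admissible_interval J" and IJ: "I = J \<or> (\<exists>c\<in>J. I = {c})"
begin

lemma I_sub: "x \<in> I \<Longrightarrow> x \<in> J" using IJ by auto

text \<open>If \<open>I = J\<close>, translating the starting point to the right stays inside \<open>I\<close>. If \<open>I = {c}\<close>, moving the window
from \<open>c\<close> to \<open>c + u\<close> costs a contribution over \<open>[c, c + H]\<close> which is independent of \<open>T\<close> and disappears after
division by \<open>T\<close>.\<close>
lemma null_mean_translate_uniform:
  assumes f: "f \<in> L1_loc J" and n: "null_mean I f" and H: "0 \<le> H" and e: "0 < e"
  obtains N where "0 < N"
    "\<And>T x u. N \<le> T \<Longrightarrow> x \<in> I \<Longrightarrow> u \<in> {0..H} \<Longrightarrow> q (x + u) (x + u + T) f \<le> e * T"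
proof -
  from IJ show thesis
  proof
    assume I: "I = J"
    from n e obtain N where N: "0 < N" "\<forall>T\<ge>N. \<forall>x\<in>I. q x (x + T) f \<le> e * T"
      unfolding null_mean_def by blast
    show thesis
    proof (rule that[OF N(1)])
      fix T x u assume T: "N \<le> T" "x \<in> I" "u \<in> {0..H}"
      then have "x + u \<in> I" using admissible_interval_nonempty_upward_closed(2)[OF J, of x "x + u"] I by auto
      then show "q (x + u) (x + u + T) f \<le> e * T" using N T by blast
    qed
  next
    assume "\<exists>c\<in>J. I = {c}"
    then obtain c where c: "c \<in> J" "I = {c}" by blast
    have "0 < e/4" using e by simp
    with n obtain N where N: "0 < N" "\<forall>T\<ge>N. q c (c + T) f \<le> e/4 * T"
      unfolding null_mean_def c(2) by blast
    define C where "C = integral {c..c + H} (\<lambda>t. norm (f t))"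
    note fi = L1_loc_cont_approximable[OF J f c(1)]
    show thesis
    \<comment> \<open>For such \<open>T\<close> one has \<open>T + u \<le> 2 T\<close> and \<open>C \<le> e T / 2\<close>, so the two halves of \<open>e T\<close> suffice.\<close>
    proof (rule that[of "max (max N H) (2 * C / e)"])
      show "0 < max (max N H) (2 * C / e)" using N(1) by simp
      fix T x u assume T: "max (max N H) (2 * C / e) \<le> T" and x: "x \<in> I" and u: "u \<in> {0..H}"
      have TT: "0 \<le> T" "u \<le> T" "N \<le> T + u" "C \<le> e * T / 2"
        using T u N(1) H e by (auto simp: field_simps)
      have "q (c + u) (c + u + T) f \<le> q c (c + u + T) f + q c (c + u) f"
        using u TT by (intro split_le fi) auto
      also have "q c (c + u + T) f \<le> e/4 * (T + u)"
        using N(2) TT(3) by (metis add.assoc add.commute)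
      also have "q c (c + u) f \<le> C"
      proof -
        have "q c (c + u) f \<le> integral {c..c + u} (\<lambda>t. norm (f t))" by (rule le_L1_norm[OF fi])
        also have "\<dots> \<le> C"
          unfolding C_def using u
          by (intro nonneg_integrable_subinterval(2)
              cont_approximable_norm_integrable fi) auto
        finally show ?thesis .
      qed
      also have "e/4 * (T + u) \<le> e/4 * (T + T)" using TT e by (intro mult_left_mono) auto
      finally show "q (x + u) (x + u + T) f \<le> e * T" using x c(2) TT(4) by (simp add: algebra_simps)
    qed
  qed
qed

text \<open>Baire's theorem on the half-line \<open>[0, \<infinity>)\<close> yields a set \<open>S n\<close> that contains \<open>[a, a + d]\<close>. Since
\<open>diff_op u \<phi> t = diff_op (a + u) \<phi> t - diff_op a \<phi> (t + u)\<close>, the bound on \<open>[a, a + d]\<close> and the one for translates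
of the fixed function \<open>diff_op a \<phi>\<close> combine to a bound for \<open>u \<in> [0, d]\<close>.\<close>
lemma diff_op_uniformly_small_near_zero:
  assumes \<phi>: "\<phi> \<in> L1_loc J" and \<Delta>: "\<And>s. 0 \<le> s \<Longrightarrow> diff_op s \<phi> \<in> L1_loc J \<and> null_mean I (diff_op s \<phi>)"
    and e: "0 < e"
  obtains d N where "0 < d" "0 < N"
    "\<And>T x u. N \<le> T \<Longrightarrow> x \<in> I \<Longrightarrow> u \<in> {0..d} \<Longrightarrow> q x (x + T) (diff_op u \<phi>) \<le> e * T"
proof -
  define S where "S n = {s\<in>{0..}. \<forall>T\<ge>real (Suc n). \<forall>x\<in>I. q x (x + T) (diff_op s \<phi>) \<le> e/2 * T}" for n
  have S_closed: "closed (S n)" for n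
  proof -
    have "S n = {0..} \<inter> (\<Inter>T\<in>{real (Suc n)..}. \<Inter>x\<in>I. {s\<in>{0..}. q x (x + T) (diff_op s \<phi>) \<le> e/2 * T})"
      by (auto simp: S_def)
    also have "closed \<dots>"
    proof (intro closed_Int closed_INT ballI)
      fix T x assume "T \<in> {real (Suc n)..}" "x \<in> I"
      then show "closed {s\<in>{0..}. q x (x + T) (diff_op s \<phi>) \<le> e/2 * T}"
        using I_sub by (intro continuous_on_closed_Collect_le
            continuous_on_seminorm_diff_op[OF J \<phi>] continuous_on_const closed_atLeast) auto
    qed simp
    finally show ?thesis .
  qed
  have cover: "\<exists>n. s \<in> S n" if s: "0 \<le> s" for s
  proof -
    obtain N where N: "0 < N" "\<forall>T\<ge>N. \<forall>x\<in>I. q x (x + T) (diff_op s \<phi>) \<le> e/2 * T"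
      using \<Delta>[OF s] e unfolding null_mean_def by (meson half_gt_zero)
    obtain n where "N < real n" using reals_Archimedean2 by blast
    then show ?thesis using N(2) s by (intro exI[of _ n]) (auto simp: S_def)
  qed
  have "\<exists>n. \<not> {0..} \<subseteq> closure ({0..} - S n)"
  proof (rule ccontr)
    assume "\<not> ?thesis"
    then have dense: "\<And>n. {0..} \<subseteq> closure ({0..} - S n)" by blast
    have "{0::real..} \<subseteq> closure (\<Inter>(range (\<lambda>n. {0..} - S n)))"
    proof (rule Baire)
      fix U assume "U \<in> range (\<lambda>n. {0..} - S n)"
      then obtain n where U: "U = {0..} - S n" by blast
      have "openin (top_of_set {0..}) U"
        unfolding U using openin_open_Int[of "- S n" "{0..}"] S_closed[of n]
        by (simp add: Diff_eq open_Compl)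
      then show "openin (top_of_set {0..}) U \<and> {0..} \<subseteq> closure U" using dense U by blast
    qed auto
    moreover have "\<Inter>(range (\<lambda>n. {0..} - S n)) = {}" using cover by auto
    ultimately show False by (metis atLeast_iff closure_empty empty_iff order_refl subsetD)
  qed
  then obtain n a where a: "0 \<le> a" "a \<notin> closure ({0..} - S n)" by auto
  then obtain r where r: "0 < r" "\<And>y. y \<in> {0..} - S n \<Longrightarrow> \<not> dist y a < r"
    unfolding closure_approachable by blast
  define d where "d = r/2"
  have d: "0 < d" using r by (simp add: d_def)
  have aS: "a + u \<in> S n" if "u \<in> {0..d}" for u
    using r(2)[of "a + u"] r(1) that a(1) by (auto simp: dist_real_def d_def)
  have \<Delta>a: "diff_op a \<phi> \<in> L1_loc J" "null_mean I (diff_op a \<phi>)" using \<Delta>[OF a(1)] by auto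
  obtain N where N: "0 < N"
    "\<And>T x u. N \<le> T \<Longrightarrow> x \<in> I \<Longrightarrow> u \<in> {0..d} \<Longrightarrow> q (x + u) (x + u + T) (diff_op a \<phi>) \<le> e/2 * T"
    by (rule null_mean_translate_uniform[OF \<Delta>a, of d "e/2"]) (use d e in auto)
  show thesis
  proof (rule that[OF d, of "max N (real (Suc n))"])
    show "0 < max N (real (Suc n))" using N(1) by simp
    fix T x u assume T: "max N (real (Suc n)) \<le> T" and x: "x \<in> I" and u: "u \<in> {0..d}"
    have "diff_op u \<phi> = (\<lambda>t. diff_op (a + u) \<phi> t - diff_op a \<phi> (t + u))"
      by (simp add: diff_op_def algebra_simps)
    then have "q x (x + T) (diff_op u \<phi>)
        \<le> q x (x + T) (diff_op (a + u) \<phi>) + q x (x + T) (\<lambda>t. diff_op a \<phi> (t + u))"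
      using u a(1) \<Delta>[of "a + u"] I_sub[OF x]
      by (simp only:) (intro diff_le L1_loc_cont_approximable[OF J]
          L1_loc_cont_approximable_translate[OF J \<Delta>a(1)]; auto)
    also have "q x (x + T) (\<lambda>t. diff_op a \<phi> (t + u)) = q (x + u) (x + u + T) (diff_op a \<phi>)"
      by (simp add: translate add.commute add.left_commute)
    also have "\<dots> \<le> e/2 * T" using N(2) T x u by simp
    also have "q x (x + T) (diff_op (a + u) \<phi>) \<le> e/2 * T"
      using aS[OF u] T x by (simp add: S_def)
    finally show "q x (x + T) (diff_op u \<phi>) \<le> e * T" by (simp add: algebra_simps)
  qed
qed

text \<open>The step \<open>d\<close> depends on \<open>e\<close>, so adding up bounds along a chain of \<open>h / d\<close> steps would lose control. Instead
\<open>s = i * d + u\<close> is reached in two moves only, from one of the finitely many fixed functions \<open>diff_op (i * d) \<phi>\<close>.\<close>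
lemma diff_op_uniformly_small:
  assumes \<phi>: "\<phi> \<in> L1_loc J" and \<Delta>: "\<And>s. 0 \<le> s \<Longrightarrow> diff_op s \<phi> \<in> L1_loc J \<and> null_mean I (diff_op s \<phi>)"
    and e: "0 < e"
  obtains N where "0 < N"
    "\<And>T x s. N \<le> T \<Longrightarrow> x \<in> I \<Longrightarrow> s \<in> {0..h} \<Longrightarrow> q x (x + T) (diff_op s \<phi>) \<le> e * T"
proof -
  have e2: "0 < e/2" using e by simp
  obtain d N where d: "0 < d" and N: "0 < N"
    "\<And>T x u. N \<le> T \<Longrightarrow> x \<in> I \<Longrightarrow> u \<in> {0..d} \<Longrightarrow> q x (x + T) (diff_op u \<phi>) \<le> e/2 * T"
    using diff_op_uniformly_small_near_zero[OF \<phi> \<Delta> e2] by blast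
  have "\<exists>N>0. \<forall>T x u. N \<le> T \<longrightarrow> x \<in> I \<longrightarrow> u \<in> {0..d} \<longrightarrow>
      q (x + u) (x + u + T) (diff_op (real i * d) \<phi>) \<le> e/2 * T" for i :: nat
  proof -
    have "0 \<le> real i * d" using d by simp
    from \<Delta>[OF this] show ?thesis
      using null_mean_translate_uniform[of "diff_op (real i * d) \<phi>" d "e/2"] d e2
      by (metis less_imp_le)
  qed
  then obtain P where P: "\<And>i. 0 < P i" "\<And>i T x u. P i \<le> T \<Longrightarrow> x \<in> I \<Longrightarrow> u \<in> {0..d} \<Longrightarrow>
      q (x + u) (x + u + T) (diff_op (real i * d) \<phi>) \<le> e/2 * T" by metis
  obtain m :: nat where m: "h / d < real m" using reals_Archimedean2 by blast
  define N' where "N' = N + (\<Sum>i\<le>m. P i)"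
  have N': "N \<le> N'" "\<And>i. i \<le> m \<Longrightarrow> P i \<le> N'" "0 < N'"
  proof -
    have s0: "0 \<le> (\<Sum>i\<le>m. P i)" using P(1) by (intro sum_nonneg) (auto intro: less_imp_le)
    then show "N \<le> N'" "0 < N'" using N(1) by (auto simp: N'_def)
    fix i assume "i \<le> m"
    then have "P i \<le> (\<Sum>i\<le>m. P i)" using P(1) by (intro member_le_sum) (auto intro: less_imp_le)
    then show "P i \<le> N'" using N(1) by (simp add: N'_def)
  qed
  show thesis
  proof (rule that[OF N'(3)])
    fix T x s assume T: "N' \<le> T" and x: "x \<in> I" and s: "s \<in> {0..h}"
    define i where "i = nat \<lfloor>s / d\<rfloor>"
    define u where "u = s - real i * d"
    have "real i \<le> s / d" "s / d < real i + 1"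
      using s d by (auto simp: i_def)
    then have u: "u \<in> {0..d}" using d by (simp add: u_def field_simps)
    have "s / d \<le> h / d" using s d by (intro divide_right_mono) auto
    then have im: "i \<le> m" using \<open>real i \<le> s / d\<close> m by linarith
    have i0: "0 \<le> real i * d" using d by simp
    note \<Delta>i = \<Delta>[OF i0]
    have "diff_op s \<phi> = (\<lambda>t. diff_op (real i * d) \<phi> (t + u) + diff_op u \<phi> t)"
      by (simp add: diff_op_def u_def algebra_simps)
    then have "q x (x + T) (diff_op s \<phi>)
        \<le> q x (x + T) (\<lambda>t. diff_op (real i * d) \<phi> (t + u)) + q x (x + T) (diff_op u \<phi>)"
      using u \<Delta>[of u] \<Delta>i I_sub[OF x]
      by (simp only:) (intro add_le L1_loc_cont_approximable[OF J]
          L1_loc_cont_approximable_translate[OF J]; auto)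
    also have "q x (x + T) (\<lambda>t. diff_op (real i * d) \<phi> (t + u))
        = q (x + u) (x + u + T) (diff_op (real i * d) \<phi>)"
      by (simp add: translate add.commute add.left_commute)
    also have "\<dots> \<le> e/2 * T" using T N'(2)[OF im] x u by (intro P(2)) auto
    also have "q x (x + T) (diff_op u \<phi>) \<le> e/2 * T" using N'(1) T x u by (intro N(2)) auto
    finally show "q x (x + T) (diff_op s \<phi>) \<le> e * T" by (simp add: algebra_simps)
  qed
qed

lemma satisfies_Delta_null_mean: "satisfies_Delta J {f \<in> L1_loc J. null_mean I f}"
  unfolding satisfies_Delta_def
proof (intro ballI impI allI)
  fix \<phi> :: "real \<Rightarrow> 'a" and h :: real
  assume \<phi>: "\<phi> \<in> L1_loc J" and \<Delta>: "\<forall>s>0. diff_op s \<phi> \<in> {f \<in> L1_loc J. null_mean I f}" and h: "0 < h"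
  have \<Delta>0: "diff_op s \<phi> \<in> L1_loc J \<and> null_mean I (diff_op s \<phi>)" if "0 \<le> s" for s
  proof (cases "s = 0")
    case True
    have "diff_op s \<phi> = (\<lambda>_. 0)" by (simp add: True diff_op_def)
    moreover have "(\<lambda>_. 0 :: 'a) \<in> L1_loc J"
      unfolding L1_loc_iff_cont_approximable[OF J] by (simp add: cont_approximable_continuous)
    moreover have "null_mean I (\<lambda>_. 0)"
      by (auto simp: null_mean_def zero intro: exI[of _ 1])
    ultimately show ?thesis by simp
  qed (use \<Delta> that in auto)
  have "null_mean I (\<lambda>t. \<phi> t - mean_op h \<phi> t)"
    unfolding null_mean_def
  proof (intro allI impI)
    fix e :: real assume e: "0 < e"
    obtain N where N: "0 < N"
      "\<And>T x s. N \<le> T \<Longrightarrow> x \<in> I \<Longrightarrow> s \<in> {0..h} \<Longrightarrow> q x (x + T) (diff_op s \<phi>) \<le> e * T"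
      using diff_op_uniformly_small[OF \<phi> \<Delta>0 e] by blast
    show "\<exists>N>0. \<forall>T\<ge>N. \<forall>x\<in>I. q x (x + T) (\<lambda>t. \<phi> t - mean_op h \<phi> t) \<le> e * T"
    proof (intro exI[of _ N] conjI allI impI ballI)
      fix T x assume "N \<le> T" "x \<in> I"
      then show "q x (x + T) (\<lambda>t. \<phi> t - mean_op h \<phi> t) \<le> e * T"
        using N h by (intro diff_mean_op_le[OF J \<phi> I_sub]) auto
    qed (rule N(1))
  qed
  then show "(\<lambda>t. \<phi> t - mean_op h \<phi> t) \<in> {f \<in> L1_loc J. null_mean I f}"
    using diff_mean_op_in_L1_loc[OF J \<phi> h] by simp
qed

end

section \<open>The four classes\<close>

interpretation integral_norm: interval_seminorm "\<lambda>a b (f::real \<Rightarrow> 'a::banach). norm (integral {a..b} f)"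
proof
  fix a b c :: real and f g :: "real \<Rightarrow> 'a"
  assume f: "cont_approximable a b f"
  show "norm (integral {a..b} f) \<le> integral {a..b} (\<lambda>t. norm (f t))"
    by (rule cont_approximable_norm_integral_le[OF f])
  show "norm (integral {a..b} (\<lambda>t. c *\<^sub>R f t)) = \<bar>c\<bar> * norm (integral {a..b} f)"
    by simp
  assume g: "cont_approximable a b g"
  show "norm (integral {a..b} (\<lambda>t. f t + g t)) \<le> norm (integral {a..b} f) + norm (integral {a..b} g)"
    using f g by (simp add: Henstock_Kurzweil_Integration.integral_add cont_approximable_integrable norm_triangle_ineq)
next
  fix a b u :: real and f :: "real \<Rightarrow> 'a"
  show "norm (integral {a..b} (\<lambda>t. f (t + u))) = norm (integral {a + u..b + u} f)"
    by (simp add: integral_translate)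
next
  fix a b c :: real and f :: "real \<Rightarrow> 'a"
  assume "a \<le> b" "b \<le> c" "cont_approximable a c f"
  then have "integral {a..b} f + integral {b..c} f = integral {a..c} f"
    by (intro Henstock_Kurzweil_Integration.integral_combine cont_approximable_integrable)
  then have "integral {b..c} f = integral {a..c} f - integral {a..b} f" by (simp add: algebra_simps)
  then show "norm (integral {b..c} f) \<le> norm (integral {a..c} f) + norm (integral {a..b} f)"
    using norm_triangle_ineq4 by metis
qed

interpretation L1_norm: interval_seminorm "\<lambda>a b (f::real \<Rightarrow> 'a::banach). integral {a..b} (\<lambda>t. norm (f t))"
proof
  fix a b c :: real and f g :: "real \<Rightarrow> 'a"
  assume f: "cont_approximable a b f"
  show "integral {a..b} (\<lambda>t. norm (f t)) \<le> integral {a..b} (\<lambda>t. norm (f t))" by simp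
  show "integral {a..b} (\<lambda>t. norm (c *\<^sub>R f t)) = \<bar>c\<bar> * integral {a..b} (\<lambda>t. norm (f t))"
    by simp
  assume g: "cont_approximable a b g"
  note i = cont_approximable_norm_integrable[OF f] cont_approximable_norm_integrable[OF g]
  have "integral {a..b} (\<lambda>t. norm (f t + g t)) \<le> integral {a..b} (\<lambda>t. norm (f t) + norm (g t))"
    by (intro integral_le cont_approximable_norm_integrable cont_approximable_add f g integrable_add i
        norm_triangle_ineq)
  then show "integral {a..b} (\<lambda>t. norm (f t + g t)) \<le> integral {a..b} (\<lambda>t. norm (f t)) + integral {a..b} (\<lambda>t. norm (g t))"
    by (simp add: Henstock_Kurzweil_Integration.integral_add i)
next
  fix a b u :: real and f :: "real \<Rightarrow> 'a"
  show "integral {a..b} (\<lambda>t. norm (f (t + u))) = integral {a + u..b + u} (\<lambda>t. norm (f t))"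
    by (rule integral_translate)
next
  fix a b c :: real and f :: "real \<Rightarrow> 'a"
  assume a: "a \<le> b" "b \<le> c" "cont_approximable a c f"
  note i = cont_approximable_norm_integrable[OF a(3)]
  have "integral {a..b} (\<lambda>t. norm (f t)) + integral {b..c} (\<lambda>t. norm (f t)) = integral {a..c} (\<lambda>t. norm (f t))"
    by (intro Henstock_Kurzweil_Integration.integral_combine a i)
  moreover have "0 \<le> integral {a..b} (\<lambda>t. norm (f t))"
    by (intro Henstock_Kurzweil_Integration.integral_nonneg integrable_on_subinterval[OF i]) (use a in auto)
  ultimately show "integral {b..c} (\<lambda>t. norm (f t))
      \<le> integral {a..c} (\<lambda>t. norm (f t)) + integral {a..b} (\<lambda>t. norm (f t))" by linarith
qed

text \<open>Translates the suprema in the definition of the ergodic mean, which live in the extended nonnegative reals since they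
could be infinite, into bounds between reals. The condition \<open>N > 0\<close> keeps \<open>T\<close> away from the division by zero.\<close>
lemma SUP_ennreal_tendsto_0_iff:
  fixes F :: "real \<Rightarrow> 'b \<Rightarrow> real"
  shows "((\<lambda>T. SUP x\<in>I. ennreal (F T x)) \<longlongrightarrow> 0) at_top
    \<longleftrightarrow> (\<forall>e>0. \<exists>N>0. \<forall>T\<ge>N. \<forall>x\<in>I. F T x \<le> e)"
proof
  assume L: "((\<lambda>T. SUP x\<in>I. ennreal (F T x)) \<longlongrightarrow> 0) at_top"
  show "\<forall>e>0. \<exists>N>0. \<forall>T\<ge>N. \<forall>x\<in>I. F T x \<le> e"
  proof (intro allI impI)
    fix e :: real assume e: "0 < e"
    have "\<forall>\<^sub>F T in at_top. (SUP x\<in>I. ennreal (F T x)) < ennreal e"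
      using order_tendstoD(2)[OF L] e by simp
    then obtain N where N: "\<And>T. N \<le> T \<Longrightarrow> (SUP x\<in>I. ennreal (F T x)) < ennreal e"
      unfolding eventually_at_top_linorder by blast
    show "\<exists>N>0. \<forall>T\<ge>N. \<forall>x\<in>I. F T x \<le> e"
    proof (intro exI[of _ "max N 1"] conjI allI impI ballI)
      fix T x assume T: "max N 1 \<le> T" "x \<in> I"
      have "ennreal (F T x) \<le> (SUP x\<in>I. ennreal (F T x))" using T(2) by (rule SUP_upper)
      then have "ennreal (F T x) \<le> ennreal e" using N[of T] T(1) by (simp add: order.strict_implies_order order_le_less_trans)
      then show "F T x \<le> e" using e by (simp add: ennreal_le_iff)
    qed simp
  qed
next
  assume R: "\<forall>e>0. \<exists>N>0. \<forall>T\<ge>N. \<forall>x\<in>I. F T x \<le> e"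
  show "((\<lambda>T. SUP x\<in>I. ennreal (F T x)) \<longlongrightarrow> 0) at_top"
  proof (rule order_tendstoI)
    fix a :: ennreal assume "0 < a"
    then obtain y where y: "0 < y" "y < a" using dense by blast
    then have "y < top" by (simp add: less_top order.strict_trans2)
    define e where "e = enn2real y"
    have e: "0 < e" "ennreal e = y" using y \<open>y < top\<close> by (auto simp: e_def enn2real_positive_iff)
    obtain N where N: "\<forall>T\<ge>N. \<forall>x\<in>I. F T x \<le> e" using R e(1) by blast
    have "(SUP x\<in>I. ennreal (F T x)) < a" if "N \<le> T" for T
    proof -
      have "(SUP x\<in>I. ennreal (F T x)) \<le> ennreal e" using N that by (intro SUP_least ennreal_leI) auto
      then show ?thesis using e(2) y(2) by simp
    qed
    then show "\<forall>\<^sub>F T in at_top. (SUP x\<in>I. ennreal (F T x)) < a"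
      unfolding eventually_at_top_linorder by blast
  qed simp
qed

lemma has_ergodic_mean_0_iff:
  fixes f :: "real \<Rightarrow> 'a::banach"
  assumes J: "admissible_interval J" and f: "f \<in> L1_loc J"
  shows "has_ergodic_mean J f 0 \<longleftrightarrow> integral_norm.null_mean J f"
proof -
  have "Bochner_integral (lebesgue_on {0..T}) (\<lambda>s. f (x + s)) = integral {x..x + T} f" if "x \<in> J" for x T
  proof -
    have c: "(\<lambda>s. f (x + s)) = (\<lambda>s. f (s + x))" by (simp add: add.commute)
    have "cont_approximable 0 T (\<lambda>s. f (s + x))"
      using that by (intro cont_approximable_translate L1_loc_cont_approximable[OF J f]) simp
    from Bochner_integral_eq_integral[OF this] show ?thesis
      unfolding c integral_translate by (simp add: add.commute)
  qed
  then have "(SUP x\<in>J. ennreal (norm ((1 / T) *\<^sub>R Bochner_integral (lebesgue_on {0..T}) (\<lambda>s. f (x + s)) - 0)))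
      = (SUP x\<in>J. ennreal (norm (integral {x..x + T} f) / \<bar>T\<bar>))" for T
    by (intro SUP_cong) auto
  then have "has_ergodic_mean J f 0 \<longleftrightarrow>
      (\<forall>e>0. \<exists>N>0. \<forall>T\<ge>N. \<forall>x\<in>J. norm (integral {x..x + T} f) / \<bar>T\<bar> \<le> e)"
    unfolding has_ergodic_mean_def by (simp only: SUP_ennreal_tendsto_0_iff)
  also have "\<dots> \<longleftrightarrow> integral_norm.null_mean J f"
    unfolding integral_norm.null_mean_def
    by (intro all_cong ex_cong conj_cong refl ball_cong imp_cong) (auto simp: field_simps)
  finally show ?thesis .
qed

lemma L1_loc_norm:
  assumes J: "admissible_interval J" and f: "f \<in> L1_loc J"
  shows "(\<lambda>t. norm (f t)) \<in> L1_loc J"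
  using f by (auto simp: L1_loc_iff_cont_approximable[OF J] intro: cont_approximable_norm)

lemma ergodic_0_eq:
  assumes J: "admissible_interval J"
  shows "ergodic_0 J = {f \<in> L1_loc J. integral_norm.null_mean J f}"
proof -
  have "f \<in> ergodic_0 J \<longleftrightarrow> f \<in> L1_loc J \<and> has_ergodic_mean J f 0" for f :: "real \<Rightarrow> 'a"
    using has_ergodic_mean_unique[OF admissible_interval_nonempty_upward_closed(1)[OF J], of f]
    unfolding ergodic_0_def ergodic_def ergodic_mean_def mem_Collect_eq
    by (metis (mono_tags, lifting) the_equality)
  then show ?thesis using has_ergodic_mean_0_iff[OF J] by auto
qed

lemma integral_norm_of_norm:
  assumes "cont_approximable a b f"
  shows "norm (integral {a..b} (\<lambda>t. norm (f t))) = integral {a..b} (\<lambda>t. norm (f t))"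
  using Henstock_Kurzweil_Integration.integral_nonneg[OF cont_approximable_norm_integrable[OF assms]] by simp

lemma null_mean_norm_iff:
  assumes J: "admissible_interval J" and f: "f \<in> L1_loc J" and I: "I \<subseteq> J"
  shows "integral_norm.null_mean I (\<lambda>t. norm (f t)) \<longleftrightarrow> L1_norm.null_mean I f"
  unfolding integral_norm.null_mean_def L1_norm.null_mean_def
  using I integral_norm_of_norm[OF L1_loc_cont_approximable[OF J f]]
  by (intro all_cong ex_cong conj_cong refl ball_cong imp_cong) auto

text \<open>The norm of an average is at most the average of the norm, so \<open>f\<close> has the ergodic mean \<open>0\<close> whenever
\<open>norm f\<close> does.\<close>
lemma ergodic_null_eq:
  assumes J: "admissible_interval J"
  shows "ergodic_null J = {f \<in> L1_loc J. L1_norm.null_mean J f}"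
proof -
  have "f \<in> ergodic J" if f: "f \<in> L1_loc J" "L1_norm.null_mean J f" for f :: "real \<Rightarrow> 'a"
  proof -
    have "norm (integral {x..x + T} f) \<le> integral {x..x + T} (\<lambda>t. norm (f t))" if "x \<in> J" for x T
      by (rule cont_approximable_norm_integral_le[OF L1_loc_cont_approximable[OF J f(1) that]])
    then have "integral_norm.null_mean J f"
      using f(2) unfolding integral_norm.null_mean_def L1_norm.null_mean_def by (meson order_trans)
    then show ?thesis using f(1) has_ergodic_mean_0_iff[OF J f(1)] by (auto simp: ergodic_def)
  qed
  moreover have "f \<in> L1_loc J" if "f \<in> ergodic J" for f :: "real \<Rightarrow> 'a"
    using that by (simp add: ergodic_def)
  ultimately show ?thesis
    using null_mean_norm_iff[OF J _ order_refl] L1_loc_norm[OF J]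
    unfolding ergodic_null_def ergodic_0_eq[OF J] by blast
qed

lemma alpha0_in:
  assumes "admissible_interval J"
  shows "alpha0 J \<in> J"
  using assms by (auto simp: admissible_interval_def alpha0_def)

lemma tendsto_0_at_top_iff:
  fixes g :: "real \<Rightarrow> 'a::real_normed_vector"
  shows "(g \<longlongrightarrow> 0) at_top \<longleftrightarrow> (\<forall>e>0. \<exists>N>0. \<forall>T\<ge>N. norm (g T) \<le> e)"
proof -
  have "(g \<longlongrightarrow> 0) at_top \<longleftrightarrow> ((\<lambda>T. ennreal (norm (g T))) \<longlongrightarrow> ennreal 0) at_top"
    by (subst tendsto_ennreal_iff) (auto simp: tendsto_norm_zero_iff)
  then show ?thesis using SUP_ennreal_tendsto_0_iff[of "\<lambda>T _. norm (g T)" "{()}"] by simp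
qed

lemma Av_0_eq:
  assumes J: "admissible_interval J"
  shows "Av_0 J = {f \<in> L1_loc J. integral_norm.null_mean {alpha0 J} f}"
proof -
  let ?a = "alpha0 J"
  have "((\<lambda>T. (1 / T) *\<^sub>R Bochner_integral (lebesgue_on {?a..?a + T}) f) \<longlongrightarrow> 0) at_top
     \<longleftrightarrow> integral_norm.null_mean {?a} f" if f: "f \<in> L1_loc J" for f :: "real \<Rightarrow> 'a"
    unfolding tendsto_0_at_top_iff integral_norm.null_mean_def
      Bochner_integral_eq_integral[OF L1_loc_cont_approximable[OF J f alpha0_in[OF J]]]
    by (intro all_cong ex_cong conj_cong refl imp_cong) (auto simp: field_simps)
  then show ?thesis by (auto simp: Av_0_def)
qed

lemma Av_null_eq:
  assumes J: "admissible_interval J"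
  shows "Av_null J = {f \<in> L1_loc J. L1_norm.null_mean {alpha0 J} f}"
proof -
  have "f \<in> Av_null J \<longleftrightarrow> f \<in> L1_loc J \<and> (\<lambda>t. norm (f t)) \<in> Av_0 J" for f :: "real \<Rightarrow> 'a"
    using L1_loc_norm[OF J] by (auto simp: Av_null_def Av_0_def)
  moreover have "{alpha0 J} \<subseteq> J" using alpha0_in[OF J] by simp
  ultimately show ?thesis
    using null_mean_norm_iff[OF J _ \<open>{alpha0 J} \<subseteq> J\<close>] L1_loc_norm[OF J]
    unfolding Av_0_eq[OF J] by blast
qed

theorem proposition7p3:
  fixes J :: "real set"
  assumes "admissible_interval J"
  shows "satisfies_Delta J (ergodic_0 J :: (real \<Rightarrow> 'a::banach) set) \<and>
         satisfies_Delta J (ergodic_null J :: (real \<Rightarrow> 'a) set) \<and>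
         satisfies_Delta J (Av_0 J :: (real \<Rightarrow> 'a) set) \<and>
         satisfies_Delta J (Av_null J :: (real \<Rightarrow> 'a) set)"
proof -
  have i: "interval_seminorm_family (\<lambda>a b (f::real \<Rightarrow> 'a). norm (integral {a..b} f)) J I"
    and l: "interval_seminorm_family (\<lambda>a b (f::real \<Rightarrow> 'a). integral {a..b} (\<lambda>t. norm (f t))) J I"
    if "I = J \<or> (\<exists>c\<in>J. I = {c})" for I
    using assms that by unfold_locales auto
  have "alpha0 J \<in> J" by (rule alpha0_in[OF assms])
  then show ?thesis
    unfolding ergodic_0_eq[OF assms] ergodic_null_eq[OF assms] Av_0_eq[OF assms] Av_null_eq[OF assms]
    by (intro conjI interval_seminorm_family.satisfies_Delta_null_mean i l) auto
qed

end
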